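(* Let $\mathcal{G}$ be a non-degenerate Hessenberg matrix. Then there exist $d\in\mathbb{Z}_+$ and $\vec{\mu}_d=(\mu_0,\dots,\mu_d)\in\mathfrak{M}_d(\mathbb{R})$, with every $\mu_k$ ($0\le k\le d$) having infinite support, such that $\langle p,q\rangle_{\vec{\mu}_d}=\langle p,q\rangle_{\mathcal{G}}$ for all $p,q\in\mathbb{P}$, if and only if there exists $d\in\mathbb{Z}_+$ such that 1. $\mathcal{G}$ is a Hessenberg-Sobolev matrix of index $d$; and 2. for each $k=0,1,\dots,d$, the Hankel matrix $\mathcal{H}_{d-k}$ defined by $$\mathcal{H}_{d-k}=\frac{(-1)^{d-k}}{(2d-2k)!}\,\Phi(\mathcal{M}_{d-k},2d-2k),$$ where $\mathcal{M}_d=\mathcal{M}_{\mathcal{G}}$ and $\mathcal{M}_{d-k}=\mathcal{M}_{d-k+1}-\mathcal{U}^{-d-1+k}\mathcal{D}_{d+1-k}\mathcal{H}_{d+1-k}\mathcal{D}_{d+1-k}\mathcal{U}^{d+1-k}$ for $k=1,\dots,d$, is a positive definite matrix of infinite order.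
   Context: $\mathbb{Z}_+=\{0,1,2,\dots\}$; $\mathbb{P}$ is the space of real polynomials. Infinite matrices have real entries indexed by $(i,j)\in\mathbb{Z}_+\times\mathbb{Z}_+$; $\mathcal{O}$ is the infinite null matrix, $\mathcal{I}$ the infinite unit matrix. All products of infinite matrices considered are such that each entry is a sum with finitely many nonzero terms. $\mathcal{U}$ is the infinite matrix with $(i,j)$ entry $\delta_{i+1,j}$; $\mathcal{U}^{-1}:=\mathcal{U}^{\mathsf T}$ and $\mathcal{U}^{-m}:=(\mathcal{U}^{-1})^m$. $[\mathcal{A}]_n$ is the matrix of the first $n$ rows and columns of $\mathcal{A}$; $\mathcal{A}$ is positive definite of infinite order if $\det([\mathcal{A}]_n)>0$ for all $n\ge 1$. A non-degenerate Hessenberg matrix is an infinite real matrix $\mathcal{G}=(g_{i,j})_{i,j\ge0}$ with $g_{i,j}=0$ whenever $j-i>1$ and $g_{i,i+1}\neq 0$ for all $i\ge 0$. The polynomials $\{Q_n\}$ generated by $\mathcal{G}$ are defined by $Q_0=t_{0,0}$ (a fixed constant $t_{0,0}>0$) and $g_{n,n+1}Q_{n+1}(x)=xQ_n(x)-\sum_{k=0}^n g_{n,k}Q_k(x)$, $n\ge 0$. Write $Q_n(x)=\sum_{i=0}^n t_{n,i}x^i$ and let $\mathcal{T}=(t_{n,i})$ be the corresponding lower triangular infinite matrix; it has a unique two-sided lower triangular inverse $\mathcal{T}^{-1}$. With $\mathcal{T}^{-\mathsf T}=(\mathcal{T}^{-1})^{\mathsf T}$, the matrix of formal moments of $\mathcal{G}$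 is $\mathcal{M}_{\mathcal{G}}=(m_{i,j}):=\mathcal{T}^{-1}\mathcal{T}^{-\mathsf T}$. For $p=\sum_{i=0}^{n_1} a_ix^i$, $q=\sum_{j=0}^{n_2} b_jx^j$, $\langle p,q\rangle_{\mathcal{G}}:=\sum_{i=0}^{n_1}\sum_{j=0}^{n_2}a_i\,m_{i,j}\,b_j$. A matrix $\mathcal{H}=(h_{i,j})$ is Hankel if $h_{i,j+1}=h_{i+1,j}$ for all $i,j\ge 0$. $\mathcal{D}_0=\mathcal{I}$ and, for $k>0$, $\mathcal{D}_k$ is the infinite diagonal matrix with $i$th diagonal entry $\frac{(k+i)!}{i!}$, $i\ge0$. $\mathcal{M}$ is a Hankel-Sobolev matrix if there are Hankel matrices $\{\mathcal{H}_k\}_{k=0}^\infty$ with $\mathcal{M}=\sum_{k=0}^{\infty}\mathcal{U}^{-k}\mathcal{D}_k\mathcal{H}_k\mathcal{D}_k\mathcal{U}^{k}$; it is of index $d\in\mathbb{Z}_+$ if $\mathcal{H}_d\neq\mathcal{O}$ and $\mathcal{H}_k=\mathcal{O}$ for all $k>d$. $\mathcal{G}$ is a Hessenberg-Sobolev matrix of index $d$ if $\mathcal{M}_{\mathcal{G}}$ is a Hankel-Sobolev matrix of index $d$. For $\eta\in\mathbb{Z}_+$, $\Phi(\mathcal{A},\eta):=\sum_{\ell=0}^{\eta}(-1)^\ell\binom{\eta}{\ell}\,\mathcal{U}^{\eta-\ell}\mathcal{A}\,\mathcal{U}^{-\ell}$. For $d\in\mathbb{Z}_+$, $\vec{\mu}_d=(\mu_0,\dots,\mu_d)\in\mathfrak{M}_d(\mathbb{R})$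 means that each $\mu_k$ is a non-negative finite Borel measure with support $\Delta_k\subset\mathbb{R}$, $\mathbb{P}\subset \mathbf{L}_1(\mu_k)$, $\mu_0$ is positive and $\Delta_0$ contains infinitely many points. For such $\vec{\mu}_d$, $\langle f,g\rangle_{\vec{\mu}_d}:=\sum_{k=0}^d\int f^{(k)}(x)g^{(k)}(x)\,d\mu_k(x)$ for $f,g\in\mathbb{P}$, where $f^{(k)}$ is the $k$th derivative. *)

theory Defs
  imports
    "HOL-Analysis.Analysis"
    "HOL-Computational_Algebra.Polynomial"
    "Jordan_Normal_Form.Determinant"
begin

section \<open>Infinite matrices\<close>

type_synonym imat = "nat \<Rightarrow> nat \<Rightarrow> real"

definition null_imat :: imat where
  "null_imat = (\<lambda>i j. 0)"

definition unit_imat :: imat where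
  "unit_imat = (\<lambda>i j. if i = j then 1 else 0)"

definition transpose_imat :: "imat \<Rightarrow> imat" where
  "transpose_imat A = (\<lambda>i j. A j i)"

text \<open>Every product formed below has only finitely many nonzero terms in each entry; the sum
  ranges over exactly these terms (and would be 0 by convention if they were infinitely many).\<close>

definition imat_mult :: "imat \<Rightarrow> imat \<Rightarrow> imat"  (infixl "\<star>" 70) where
  "A \<star> B = (\<lambda>i j. \<Sum>k\<in>{k. A i k * B k j \<noteq> 0}. A i k * B k j)"

primrec imat_power :: "imat \<Rightarrow> nat \<Rightarrow> imat" where
  "imat_power A 0 = unit_imat"
| "imat_power A (Suc n) = A \<star> imat_power A n"

definition shift_imat :: imat where
  "shift_imat = (\<lambda>i j. if i + 1 = j then 1 else 0)"

definition shift_pow :: "nat \<Rightarrow> imat" where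
  "shift_pow m = imat_power shift_imat m"

text \<open>The power of exponent \<open>-m\<close> of the shift; its inverse is by convention its transpose,
  which is only a right inverse of it.\<close>

definition shift_neg_pow :: "nat \<Rightarrow> imat" where
  "shift_neg_pow m = imat_power (transpose_imat shift_imat) m"

definition pos_def_imat :: "imat \<Rightarrow> bool" where
  "pos_def_imat A \<longleftrightarrow> (\<forall>n\<ge>1. Determinant.det (Matrix.mat n n (\<lambda>(i, j). A i j)) > 0)"

definition lower_triangular_imat :: "imat \<Rightarrow> bool" where
  "lower_triangular_imat A \<longleftrightarrow> (\<forall>i j. i < j \<longrightarrow> A i j = 0)"

definition lower_inverse :: "imat \<Rightarrow> imat" where
  "lower_inverse A =
     (THE B. lower_triangular_imat B \<and> A \<star> B = unit_imat \<and> B \<star> A = unit_imat)"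


section \<open>Hessenberg matrices, generated polynomials, formal moments\<close>

definition nondegenerate_hessenberg :: "imat \<Rightarrow> bool" where
  "nondegenerate_hessenberg G \<longleftrightarrow>
     (\<forall>i j. j > i + 1 \<longrightarrow> G i j = 0) \<and> (\<forall>i. G i (i + 1) \<noteq> 0)"

text \<open>The argument \<open>c\<close> is the constant value of the initial polynomial;
  \<open>pCons 0 p\<close> is \<open>p\<close> multiplied by the indeterminate.\<close>

fun gen_poly :: "real \<Rightarrow> imat \<Rightarrow> nat \<Rightarrow> real poly" where
  "gen_poly c G 0 = [:c:]"
| "gen_poly c G (Suc n) =
     Polynomial.smult (1 / G n (n + 1))
       (pCons 0 (gen_poly c G n) - (\<Sum>k\<le>n. Polynomial.smult (G n k) (gen_poly c G k)))"

definition coeff_imat :: "real \<Rightarrow> imat \<Rightarrow> imat" where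
  "coeff_imat c G = (\<lambda>n i. Polynomial.coeff (gen_poly c G n) i)"

definition formal_moments :: "real \<Rightarrow> imat \<Rightarrow> imat" where
  "formal_moments c G =
     lower_inverse (coeff_imat c G) \<star> transpose_imat (lower_inverse (coeff_imat c G))"

definition formal_inner :: "real \<Rightarrow> imat \<Rightarrow> real poly \<Rightarrow> real poly \<Rightarrow> real" where
  "formal_inner c G p q =
     (\<Sum>i\<le>Polynomial.degree p. \<Sum>j\<le>Polynomial.degree q.
        Polynomial.coeff p i * formal_moments c G i j * Polynomial.coeff q j)"


section \<open>Hankel-Sobolev matrices\<close>

definition hankel :: "imat \<Rightarrow> bool" where
  "hankel H \<longleftrightarrow> (\<forall>i j. H i (j + 1) = H (i + 1) j)"

definition diag_imat :: "nat \<Rightarrow> imat" where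
  "diag_imat k = (\<lambda>i j. if i = j then fact (k + i) / fact i else 0)"

definition sobolev_term :: "nat \<Rightarrow> imat \<Rightarrow> imat" where
  "sobolev_term k H = shift_neg_pow k \<star> diag_imat k \<star> H \<star> diag_imat k \<star> shift_pow k"

definition hankel_sobolev_decomp :: "imat \<Rightarrow> (nat \<Rightarrow> imat) \<Rightarrow> bool" where
  "hankel_sobolev_decomp M H \<longleftrightarrow>
     (\<forall>k. hankel (H k)) \<and> (\<forall>i j. (\<lambda>k. sobolev_term k (H k) i j) sums M i j)"

definition hankel_sobolev_of_index :: "nat \<Rightarrow> imat \<Rightarrow> bool" where
  "hankel_sobolev_of_index d M \<longleftrightarrow>
     (\<exists>H. hankel_sobolev_decomp M H \<and> H d \<noteq> null_imat \<and> (\<forall>k>d. H k = null_imat))"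

definition hessenberg_sobolev_of_index :: "real \<Rightarrow> nat \<Rightarrow> imat \<Rightarrow> bool" where
  "hessenberg_sobolev_of_index c d G \<longleftrightarrow>
     nondegenerate_hessenberg G \<and> hankel_sobolev_of_index d (formal_moments c G)"

definition Phi :: "imat \<Rightarrow> nat \<Rightarrow> imat" where
  "Phi A \<eta> = (\<lambda>i j. \<Sum>l\<le>\<eta>. (-1) ^ l * real (\<eta> choose l) *
     (shift_pow (\<eta> - l) \<star> A \<star> shift_neg_pow l) i j)"

definition hankel_part :: "nat \<Rightarrow> imat \<Rightarrow> imat" where
  "hankel_part e A = (\<lambda>i j. (-1) ^ e / fact (2 * e) * Phi A (2 * e) i j)"

text \<open>For \<open>k \<le> d\<close>, \<open>residual M d k\<close> and \<open>extracted M d k\<close> are the matrices usually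
  indexed by \<open>d - k\<close>: starting from \<open>M\<close>, the terms of order \<open>d, d - 1, \<dots>\<close> are
  successively extracted and subtracted.\<close>

primrec residual :: "imat \<Rightarrow> nat \<Rightarrow> nat \<Rightarrow> imat" where
  "residual M d 0 = M"
| "residual M d (Suc k) = (\<lambda>i j. residual M d k i j -
     sobolev_term (d - k) (hankel_part (d - k) (residual M d k)) i j)"

definition extracted :: "imat \<Rightarrow> nat \<Rightarrow> nat \<Rightarrow> imat" where
  "extracted M d k = hankel_part (d - k) (residual M d k)"


section \<open>Sobolev inner products\<close>

definition measure_support :: "real measure \<Rightarrow> real set" where
  "measure_support \<mu> = {x. \<forall>U. open U \<and> x \<in> U \<longrightarrow> emeasure \<mu> U > 0}"

text \<open>Only the components \<open>\<mu> 0, \<dots>, \<mu> d\<close> are relevant.\<close>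

definition sobolev_measures :: "nat \<Rightarrow> (nat \<Rightarrow> real measure) \<Rightarrow> bool" where
  "sobolev_measures d \<mu> \<longleftrightarrow>
     (\<forall>k\<le>d. sets (\<mu> k) = sets borel \<and> finite_measure (\<mu> k) \<and>
            (\<forall>p :: real poly. integrable (\<mu> k) (poly p))) \<and>
     emeasure (\<mu> 0) UNIV > 0 \<and> infinite (measure_support (\<mu> 0))"

definition sobolev_inner ::
    "nat \<Rightarrow> (nat \<Rightarrow> real measure) \<Rightarrow> real poly \<Rightarrow> real poly \<Rightarrow> real" where
  "sobolev_inner d \<mu> f g =
     (\<Sum>k\<le>d. \<integral>x. poly ((pderiv ^^ k) f) x * poly ((pderiv ^^ k) g) x \<partial>\<mu> k)"

end

theory Submission
  imports
    Defs
    "HOL-Computational_Algebra.Fundamental_Theorem_Algebra"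
    "HOL-Probability.Helly_Selection"
begin

text \<open>
  Evaluated on monomials, the Sobolev inner product equals the formal one iff the matrix of formal
  moments is the Hankel-Sobolev sum built from the moment matrices of the \<open>\<mu>\<^sub>k\<close>. In such a sum, the
  term of order \<open>k\<close> restricted to an antidiagonal is a polynomial of degree \<open>2k\<close> in the position, with
  leading coefficient \<open>(-1)\<^sup>k\<close> times the Hankel entry; \<open>\<Phi>\<close> is a finite difference of order \<open>2d\<close> along
  antidiagonals, so it annihilates all terms below order \<open>d\<close> and returns \<open>H\<^sub>d\<close> up to a factor. Hence
  the extraction recovers every \<open>H\<^sub>k\<close>, and the theorem reduces to Hamburger's moment problem: a
  Hankel matrix is positive definite iff it is the moment matrix of a measure with infinite support.
  The measure is a weak limit of Gauss quadratures, tight because the second moments are constant.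
\<close>

section \<open>Recovering the Hankel matrices of a Hankel-Sobolev sum\<close>

text \<open>\<open>imat_mult\<close> sums over the nonzero terms only, a set that varies with the
  entry. Every product expanded below has a factor with at most one nonzero entry in the relevant
  row or column, so the sum collapses to one term.\<close>

lemma imat_mult_row:
  assumes "\<And>k. k \<noteq> m \<Longrightarrow> A i k = 0"
  shows "(A \<star> B) i j = A i m * B m j"
proof -
  have "{k. A i k * B k j \<noteq> 0} \<subseteq> {m}" using assms by force
  then show ?thesis
    unfolding imat_mult_def by (subst sum.mono_neutral_left[of "{m}"]) auto
qed

lemma imat_mult_col:
  assumes "\<And>k. k \<noteq> m \<Longrightarrow> B k j = 0"
  shows "(A \<star> B) i j = A i m * B m j"
proof -
  have "{k. A i k * B k j \<noteq> 0} \<subseteq> {m}" using assms by force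
  then show ?thesis
    unfolding imat_mult_def by (subst sum.mono_neutral_left[of "{m}"]) auto
qed

lemma shift_pow_nth: "shift_pow m i j = (if i + m = j then 1 else 0)"
proof (induction m arbitrary: i)
  case 0
  show ?case by (simp add: shift_pow_def unit_imat_def)
next
  case (Suc m)
  have "shift_pow (Suc m) i j = (shift_imat \<star> shift_pow m) i j"
    by (simp add: shift_pow_def)
  also have "\<dots> = shift_imat i (Suc i) * shift_pow m (Suc i) j"
    by (rule imat_mult_row) (simp add: shift_imat_def)
  finally show ?case by (simp add: Suc.IH shift_imat_def)
qed

lemma shift_neg_pow_nth: "shift_neg_pow m i j = (if i = j + m then 1 else 0)"
proof (induction m arbitrary: i)
  case 0
  show ?case by (simp add: shift_neg_pow_def unit_imat_def)
next
  case (Suc m)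
  have "shift_neg_pow (Suc m) i j = (transpose_imat shift_imat \<star> shift_neg_pow m) i j"
    by (simp add: shift_neg_pow_def)
  \<comment> \<open>For \<open>i = 0\<close> the truncated index \<open>i - 1\<close> is 0, where
    the entry of the transposed shift vanishes as well.\<close>
  also have "\<dots> = transpose_imat shift_imat i (i - 1) * shift_neg_pow m (i - 1) j"
    by (rule imat_mult_row) (auto simp: shift_imat_def transpose_imat_def)
  finally show ?case
    by (cases i) (auto simp: Suc.IH shift_imat_def transpose_imat_def)
qed

text \<open>Multiplying by powers of the shift only moves entries. All terms lie on the antidiagonal
  of index sum \<open>i + j + \<eta>\<close>, and \<open>Phi\<close> is a finite difference of order
  \<open>\<eta>\<close> along it.\<close>

lemma Phi_nth:
  "Phi A \<eta> i j = (\<Sum>l\<le>\<eta>. (-1) ^ l * real (\<eta> choose l) * A (i + \<eta> - l) (j + l))"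
  unfolding Phi_def
proof (rule sum.cong, rule refl)
  fix l assume "l \<in> {..\<eta>}"
  then have l: "i + (\<eta> - l) = i + \<eta> - l" by auto
  have "(shift_pow (\<eta> - l) \<star> A \<star> shift_neg_pow l) i j
      = (shift_pow (\<eta> - l) \<star> A) i (j + l) * shift_neg_pow l (j + l) j"
    by (rule imat_mult_col) (simp add: shift_neg_pow_nth)
  also have "(shift_pow (\<eta> - l) \<star> A) i (j + l)
      = shift_pow (\<eta> - l) i (i + (\<eta> - l)) * A (i + (\<eta> - l)) (j + l)"
    by (rule imat_mult_row) (simp add: shift_pow_nth)
  finally show "(-1) ^ l * real (\<eta> choose l) * (shift_pow (\<eta> - l) \<star> A \<star> shift_neg_pow l) i j
      = (-1) ^ l * real (\<eta> choose l) * A (i + \<eta> - l) (j + l)"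
    using shift_pow_nth[of "\<eta> - l" i "i + (\<eta> - l)"] shift_neg_pow_nth[of l "j + l" j]
    by (simp only: l if_True mult_1 mult_1_right refl)
qed

text \<open>The falling factorial, a polynomial in \<open>i\<close> that vanishes for
  \<open>i < k\<close>. The diagonal matrices produce the quotient on the right; finite differences
  and derivatives need the product.\<close>

lemma prod_diff_eq_fact_quotient:
  "(\<Prod>t<k. real i - real t) = (if k \<le> i then fact i / fact (i - k) else 0)"
proof (induction k)
  case (Suc k)
  show ?case
  proof (cases "Suc k \<le> i")
    case True
    then have "i - k = Suc (i - Suc k)" by simp
    then have "fact (i - k) = (real i - real k) * (fact (i - Suc k) :: real)"
      using True by (simp add: of_nat_diff)
    moreover have "(\<Prod>t<Suc k. real i - real t) = fact i / fact (i - k) * (real i - real k)"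
      using Suc True by simp
    moreover have "real i - real k \<noteq> 0" using True by auto
    ultimately show ?thesis using True by simp
  next
    case False
    then show ?thesis using Suc by (cases "k = i") auto
  qed
qed simp

text \<open>If \<open>H\<close> holds the moments of a measure, this is the integral of the product
  of the \<open>k\<close>-th derivatives of \<open>x^i\<close> and \<open>x^j\<close>. For
  \<open>i < k\<close> or \<open>j < k\<close> a factor is zero, so the truncated indices do no
  harm.\<close>

lemma sobolev_term_nth:
  "sobolev_term k H i j
     = (\<Prod>t<k. real i - real t) * (\<Prod>t<k. real j - real t) * H (i - k) (j - k)"
proof -
  let ?D = "diag_imat k"
  have 1: "sobolev_term k H i j
      = (shift_neg_pow k \<star> ?D \<star> H \<star> ?D) i (j - k) * shift_pow k (j - k) j"
    unfolding sobolev_term_def by (rule imat_mult_col) (auto simp: shift_pow_nth)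
  have 2: "(shift_neg_pow k \<star> ?D \<star> H \<star> ?D) i (j - k)
      = (shift_neg_pow k \<star> ?D \<star> H) i (j - k) * ?D (j - k) (j - k)"
    by (rule imat_mult_col) (simp add: diag_imat_def)
  have 3: "(shift_neg_pow k \<star> ?D) i l = shift_neg_pow k i (i - k) * ?D (i - k) l" for l
    by (rule imat_mult_row) (auto simp: shift_neg_pow_nth)
  have 4: "(shift_neg_pow k \<star> ?D \<star> H) i (j - k)
      = (shift_neg_pow k \<star> ?D) i (i - k) * H (i - k) (j - k)"
    by (rule imat_mult_row) (unfold 3, simp add: diag_imat_def)
  have 5: "?D m m = fact (k + m) / fact m" for m by (simp add: diag_imat_def)
  show ?thesis
    unfolding prod_diff_eq_fact_quotient 1 2 4 3 5 shift_pow_nth shift_neg_pow_nth by auto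
qed

section \<open>Finite differences of polynomials\<close>

lemma pcompose_monom_eq: "pcompose (monom c n) q = Polynomial.smult c (q ^ n)"
  by (induction n) (simp_all add: monom_0 monom_Suc pcompose_pCons pcompose_const)

lemma coeff_pcompose_shift:
  fixes p :: "real poly"
  assumes "degree p \<le> n"
  shows "coeff (pcompose p [:1, 1:]) i = (\<Sum>m\<le>n. coeff p m * real (m choose i))"
proof -
  have "p = (\<Sum>m\<le>n. monom (coeff p m) m)"
    using poly_as_sum_of_monoms'[OF assms] by simp
  then have "pcompose p [:1, 1:] = (\<Sum>m\<le>n. pcompose (monom (coeff p m) m) [:1, 1:])"
    by (metis pcompose_sum)
  also have "\<dots> = (\<Sum>m\<le>n. Polynomial.smult (coeff p m) ([:1, 1:] ^ m))"
    by (simp add: pcompose_monom_eq)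
  finally have "coeff (pcompose p [:1, 1:]) i = (\<Sum>m\<le>n. coeff p m * coeff ([:1, 1:] ^ m) i)"
    by (simp add: coeff_sum)
  moreover have "coeff ([:1, 1 :: real:] ^ m) i = real (m choose i)" for m
  proof (cases "i \<le> m")
    case False
    then have "degree ([:1, 1 :: real:] ^ m) < i"
      using degree_power_le[of "[:1, 1 :: real:]" m] by simp
    then show ?thesis using False by (simp add: coeff_eq_0 binomial_eq_0)
  qed (simp add: coeff_linear_poly_power)
  ultimately show ?thesis by simp
qed

text \<open>Passing from \<open>p(x)\<close> to \<open>p(x) - p(x + 1)\<close> lowers the degree
  bound from \<open>n + 1\<close> to \<open>n\<close> and multiplies the top coefficient by
  \<open>-(n + 1)\<close>; iterating produces the sign and the factorial. Since \<open>n\<close>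
  only bounds the degree, polynomials of smaller degree give 0.\<close>

lemma alternating_binomial_sum_poly:
  fixes p :: "real poly"
  assumes "degree p \<le> n"
  shows "(\<Sum>l\<le>n. (-1) ^ l * real (n choose l) * poly p (real l)) = (-1) ^ n * fact n * coeff p n"
  using assms
proof (induction n arbitrary: p)
  case 0
  then obtain c where "p = [:c:]" by (metis degree_eq_zeroE le_zero_eq)
  then show ?case by simp
next
  case (Suc n)
  define q where "q = p - pcompose p [:1, 1:]"
  have c: "coeff (pcompose p [:1, 1:]) i
      = (\<Sum>m\<le>n. coeff p m * real (m choose i)) + coeff p (Suc n) * real (Suc n choose i)" for i
    by (simp add: coeff_pcompose_shift[OF Suc.prems])
  have "coeff q i = 0" if "i > n" for i
  proof (cases "i = Suc n")
    case True
    then show ?thesis unfolding q_def coeff_diff c by (simp add: binomial_eq_0)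
  next
    case False
    then have "i > Suc n" using that by simp
    then show ?thesis using Suc.prems unfolding q_def coeff_diff c
      by (simp add: binomial_eq_0 coeff_eq_0 del: binomial_Suc_Suc)
  qed
  then have dq: "degree q \<le> n" by (meson degree_le)
  have "(\<Sum>m\<le>n. coeff p m * real (m choose n)) = (\<Sum>m\<in>{n}. coeff p m * real (m choose n))"
    by (rule sum.mono_neutral_right) (auto simp: binomial_eq_0)
  then have cq: "coeff q n = - real (Suc n) * coeff p (Suc n)"
    unfolding q_def coeff_diff c by (simp add: algebra_simps)
  have "(\<Sum>l\<le>Suc n. (-1) ^ l * real (Suc n choose l) * poly p (real l))
      = (\<Sum>l\<le>n. (-1) ^ l * real (n choose l) * poly q (real l))"
  proof -
    let ?f = "\<lambda>l. poly p (real l)"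
    have "(\<Sum>l\<le>Suc n. (-1) ^ l * real (Suc n choose l) * ?f l)
        = ?f 0 + (\<Sum>l\<le>n. (-1) ^ Suc l * real (Suc n choose Suc l) * ?f (Suc l))"
      by (subst sum.atMost_Suc_shift) simp
    \<comment> \<open>Pascal's rule splits each coefficient. The part with
      \<open>n choose Suc l\<close> joins \<open>?f 0\<close> to form the sum for \<open>n\<close>,
      its last term being zero; the other part is the same sum for the translated
      polynomial.\<close>
    also have "\<dots> = ?f 0 + (\<Sum>l\<le>n. (-1) ^ Suc l * real (n choose Suc l) * ?f (Suc l))
        - (\<Sum>l\<le>n. (-1) ^ l * real (n choose l) * ?f (Suc l))"
      by (simp add: algebra_simps sum.distrib sum_subtractf sum_negf)
    also have "?f 0 + (\<Sum>l\<le>n. (-1) ^ Suc l * real (n choose Suc l) * ?f (Suc l))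
        = (\<Sum>l\<le>Suc n. (-1) ^ l * real (n choose l) * ?f l)"
      by (simp only: sum.atMost_Suc_shift) simp
    also have "\<dots> = (\<Sum>l\<le>n. (-1) ^ l * real (n choose l) * ?f l)"
      by (simp add: binomial_eq_0)
    also have "\<dots> - (\<Sum>l\<le>n. (-1) ^ l * real (n choose l) * ?f (Suc l))
        = (\<Sum>l\<le>n. (-1) ^ l * real (n choose l) * poly q (real l))"
      unfolding q_def
      by (simp add: poly_pcompose sum_subtractf[symmetric] right_diff_distrib add.commute)
    finally show ?thesis .
  qed
  also have "\<dots> = (-1) ^ n * fact n * coeff q n" by (rule Suc.IH[OF dq])
  also have "\<dots> = (-1) ^ Suc n * fact (Suc n) * coeff p (Suc n)"
    by (simp add: cq algebra_simps)
  finally show ?case .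
qed

section \<open>Extraction of the Hankel matrices\<close>

lemma hankel_nth:
  assumes "hankel H"
  shows "H i j = H 0 (i + j)"
proof (induction i arbitrary: j)
  case (Suc i)
  have "H (Suc i) j = H i (Suc j)" using assms unfolding hankel_def by simp
  then show ?case using Suc.IH[of "Suc j"] by simp
qed simp

lemma degree_prod_linear_le:
  "degree (\<Prod>t<(k::nat). [:a t, b t :: real:]) \<le> k"
  using degree_prod_sum_le[of "{..<k}" "\<lambda>t. [:a t, b t:]"]
    sum_mono[of "{..<k}" "\<lambda>t. degree [:a t, b t:]" "\<lambda>_. 1"]
  by (force simp: o_def)

lemma coeff_prod_linear:
  "coeff (\<Prod>t<(k::nat). [:a t, b t :: real:]) k = (\<Prod>t<k. b t)"
proof (induction k)
  case (Suc k)
  have "coeff (\<Prod>t<k. [:a t, b t:]) (Suc k) = 0"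
    using degree_prod_linear_le[where k = k and a = a and b = b] by (intro coeff_eq_0) simp
  then show ?case using Suc by (simp add: mult.commute)
qed simp

lemma Phi_sobolev_term:
  assumes H: "hankel H" and k: "k \<le> d"
  shows "Phi (sobolev_term k H) (2 * d) i j = (if k = d then (-1) ^ d * fact (2 * d) * H i j else 0)"
proof -
  \<comment> \<open>The two falling factorials at position \<open>(i + 2 * d - l, j + l)\<close>,
    read as polynomials in \<open>l\<close>. Their slopes -1 and 1 account for the top coefficient
    \<open>(-1) ^ k\<close> of the product.\<close>
  define f where "f = (\<Prod>t<k. [:real i + 2 * real d - real t, -1:])"
  define g where "g = (\<Prod>t<k. [:real j - real t, 1:])"
  have df: "degree f \<le> k" and dg: "degree g \<le> k"
    unfolding f_def g_def by (rule degree_prod_linear_le)+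
  have dfg: "degree (f * g) \<le> 2 * k"
    using degree_mult_le[of f g] df dg by linarith
  have cfg: "coeff (f * g) (2 * k) = (-1) ^ k"
  proof -
    have f: "coeff f k = (-1) ^ k" and g: "coeff g k = 1"
      unfolding f_def g_def coeff_prod_linear by simp_all
    then have "degree f = k" "degree g = k"
      using df dg le_degree[of f k] le_degree[of g k] by auto
    then show ?thesis using coeff_mult_degree_sum[of f g] f g by (simp add: mult_2)
  qed
  have "sobolev_term k H (i + 2 * d - l) (j + l) = poly (f * g) (real l) * H 0 (i + j + 2 * d - 2 * k)"
    if "l \<le> 2 * d" for l
  proof -
    have 1: "(\<Prod>t<k. real (i + 2 * d - l) - real t) = poly f (real l)"
      unfolding f_def poly_prod using that by (intro prod.cong) (auto simp: of_nat_diff)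
    have 2: "(\<Prod>t<k. real (j + l) - real t) = poly g (real l)"
      unfolding g_def poly_prod by (intro prod.cong) auto
    show ?thesis
    proof (cases "k \<le> i + 2 * d - l \<and> k \<le> j + l")
      case True
      have "H (i + 2 * d - l - k) (j + l - k) = H 0 (i + j + 2 * d - 2 * k)"
      proof -
        have "i + 2 * d - l - k + (j + l - k) = i + j + 2 * d - 2 * k" using True that by linarith
        then show ?thesis by (metis hankel_nth[OF H])
      qed
      then show ?thesis by (simp add: sobolev_term_nth 1 2[simplified])
    next
      case False
      \<comment> \<open>Here truncated subtraction leaves the antidiagonal, so the entry of
        \<open>H\<close> may be a different one; both sides are zero because a falling factorial
        vanishes.\<close>
      then have "poly f (real l) = 0 \<or> poly g (real l) = 0"
        unfolding 1[symmetric] 2[symmetric] prod_diff_eq_fact_quotient by auto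
      then show ?thesis using 2 by (auto simp: sobolev_term_nth 1 simp del: of_nat_add)
    qed
  qed
  then have "Phi (sobolev_term k H) (2 * d) i j
      = (\<Sum>l\<le>2 * d. (-1) ^ l * real (2 * d choose l) * poly (f * g) (real l))
        * H 0 (i + j + 2 * d - 2 * k)"
    by (simp add: Phi_nth sum_distrib_right mult.assoc)
  also have "\<dots> = fact (2 * d) * coeff (f * g) (2 * d) * H 0 (i + j + 2 * d - 2 * k)"
    using alternating_binomial_sum_poly[of "f * g" "2 * d"] dfg k by simp
  also have "\<dots> = (if k = d then (-1) ^ d * fact (2 * d) * H i j else 0)"
    using cfg dfg k hankel_nth[OF H, of i j] by (auto simp: coeff_eq_0)
  finally show ?thesis .
qed

lemma hankel_part_sobolev_sum:
  assumes "\<And>k. hankel (H k)"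
  shows "hankel_part d (\<lambda>i j. \<Sum>k\<le>d. sobolev_term k (H k) i j) = H d"
proof (intro ext)
  fix i j
  have "Phi (\<lambda>i j. \<Sum>k\<le>d. sobolev_term k (H k) i j) (2 * d) i j
      = (\<Sum>k\<le>d. Phi (sobolev_term k (H k)) (2 * d) i j)"
    unfolding Phi_nth by (simp add: sum_distrib_left) (rule sum.swap)
  also have "\<dots> = (-1) ^ d * fact (2 * d) * H d i j"
    by (simp add: Phi_sobolev_term[OF assms])
  finally show "hankel_part d (\<lambda>i j. \<Sum>k\<le>d. sobolev_term k (H k) i j) i j = H d i j"
    by (simp add: hankel_part_def flip: power_add mult_2)
qed

text \<open>After \<open>m\<close> extractions the residual is the same sum cut off at order
  \<open>d - m\<close>, so each extraction again acts on a top-order term. In particular the sum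
  determines its Hankel matrices.\<close>

lemma extracted_sobolev_sum:
  assumes H: "\<And>k. hankel (H k)" and m: "m \<le> d"
  shows "extracted (\<lambda>i j. \<Sum>k\<le>d. sobolev_term k (H k) i j) d m = H (d - m)"
proof -
  have "residual (\<lambda>i j. \<Sum>k\<le>d. sobolev_term k (H k) i j) d m
      = (\<lambda>i j. \<Sum>k\<le>d - m. sobolev_term k (H k) i j)"
    using m
  proof (induction m)
    case (Suc m)
    then have "d - m = Suc (d - Suc m)" by simp
    moreover have "residual (\<lambda>i j. \<Sum>k\<le>d. sobolev_term k (H k) i j) d m
        = (\<lambda>i j. \<Sum>k\<le>d - m. sobolev_term k (H k) i j)"
      using Suc by simp
    ultimately show ?case
      by (simp only: residual.simps hankel_part_sobolev_sum[where H = H, OF H]) simp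
  qed simp
  then show ?thesis by (simp add: extracted_def hankel_part_sobolev_sum[OF H])
qed

section \<open>Moment functionals and orthogonal polynomials\<close>

definition moment_functional :: "(nat \<Rightarrow> real) \<Rightarrow> real poly \<Rightarrow> real" where
  "moment_functional h p = (\<Sum>i\<le>degree p. coeff p i * h i)"

lemma moment_functional_le:
  "degree p \<le> n \<Longrightarrow> moment_functional h p = (\<Sum>i\<le>n. coeff p i * h i)"
  unfolding moment_functional_def
  by (rule sum.mono_neutral_left) (auto simp: coeff_eq_0)

lemma moment_functional_add:
  "moment_functional h (p + q) = moment_functional h p + moment_functional h q"
proof -
  let ?n = "max (degree p) (degree q)"
  have "moment_functional h r = (\<Sum>i\<le>?n. coeff r i * h i)" if "r \<in> {p, q, p + q}" for r
    using that by (intro moment_functional_le) (auto intro: degree_add_le)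
  then show ?thesis by (simp add: sum.distrib distrib_right)
qed

lemma moment_functional_smult:
  "moment_functional h (Polynomial.smult c p) = c * moment_functional h p"
  by (simp add: moment_functional_le[of "Polynomial.smult c p" "degree p"] moment_functional_def
      sum_distrib_left mult.assoc)

lemma moment_functional_0 [simp]: "moment_functional h 0 = 0"
  by (simp add: moment_functional_def)

lemma moment_functional_diff:
  "moment_functional h (p - q) = moment_functional h p - moment_functional h q"
  using moment_functional_add[of h "p - q" q] by simp

lemma moment_functional_sum:
  "moment_functional h (\<Sum>i\<in>A. f i) = (\<Sum>i\<in>A. moment_functional h (f i))"
  by (induction A rule: infinite_finite_induct) (auto simp: moment_functional_add)

lemma moment_functional_monom [simp]: "moment_functional h (monom c n) = c * h n"
proof -
  have "moment_functional h (monom c n) = (\<Sum>i\<le>n. coeff (monom c n) i * h i)"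
    by (rule moment_functional_le) (rule degree_monom_le)
  also have "\<dots> = (\<Sum>i\<in>{n}. coeff (monom c n) i * h i)"
    by (rule sum.mono_neutral_right) (auto simp: coeff_monom)
  finally show ?thesis by simp
qed

lemma moment_functional_mult:
  assumes "degree p \<le> m" "degree q \<le> n"
  shows "moment_functional h (p * q) = (\<Sum>i\<le>m. \<Sum>j\<le>n. coeff p i * coeff q j * h (i + j))"
proof -
  have "p * q = (\<Sum>i\<le>m. monom (coeff p i) i) * (\<Sum>j\<le>n. monom (coeff q j) j)"
    using assms by (simp add: poly_as_sum_of_monoms')
  also have "\<dots> = (\<Sum>i\<le>m. \<Sum>j\<le>n. monom (coeff p i * coeff q j) (i + j))"
    by (simp add: sum_product mult_monom)
  finally show ?thesis by (simp add: moment_functional_sum)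
qed

section \<open>Orthogonal polynomials\<close>

text \<open>Gram-Schmidt on the monomials without normalization, so every polynomial is monic
  whatever \<open>h\<close> is. If a norm vanishes, division by zero gives coefficient 0.\<close>

fun orth_poly :: "(nat \<Rightarrow> real) \<Rightarrow> nat \<Rightarrow> real poly" where
  "orth_poly h n = monom 1 n - (\<Sum>j<n. Polynomial.smult
     (moment_functional h (monom 1 n * orth_poly h j) /
      moment_functional h (orth_poly h j * orth_poly h j)) (orth_poly h j))"

declare orth_poly.simps [simp del]

abbreviation orth_norm :: "(nat \<Rightarrow> real) \<Rightarrow> nat \<Rightarrow> real" where
  "orth_norm h n \<equiv> moment_functional h (orth_poly h n * orth_poly h n)"

lemma orth_poly_degree_coeff: "degree (orth_poly h n) \<le> n \<and> coeff (orth_poly h n) n = 1"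
proof (induction n rule: less_induct)
  case (less n)
  let ?s = "\<Sum>j<n. Polynomial.smult (moment_functional h (monom 1 n * orth_poly h j) / orth_norm h j)
     (orth_poly h j)"
  have "coeff ?s i = 0" if "i \<ge> n" for i
    unfolding coeff_sum
  proof (rule sum.neutral, rule ballI)
    fix j assume j: "j \<in> {..<n}"
    then have "degree (orth_poly h j) \<le> j" using less by auto
    then have "coeff (orth_poly h j) i = 0" using j that by (intro coeff_eq_0) auto
    then show "coeff (Polynomial.smult
      (moment_functional h (monom 1 n * orth_poly h j) / orth_norm h j) (orth_poly h j)) i = 0" by simp
  qed
  then have "coeff (orth_poly h n) i = coeff (monom 1 n) i" if "i \<ge> n" for i
    using that by (subst orth_poly.simps) simp
  then show ?case by (auto intro!: degree_le simp: coeff_monom)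
qed

lemma degree_orth_poly [simp]: "degree (orth_poly h n) = n"
  using orth_poly_degree_coeff[of h n] le_degree[of "orth_poly h n" n] by simp

lemma coeff_orth_poly_self [simp]: "coeff (orth_poly h n) n = 1"
  using orth_poly_degree_coeff by blast

lemma orth_poly_nonzero [simp]: "orth_poly h n \<noteq> 0"
  using coeff_orth_poly_self[of h n] by fastforce

text \<open>Each projection coefficient cancels one inner product. Only norms below \<open>n\<close>
  are assumed nonzero, so that the determinant formula built on this can serve inside the induction
  that proves the norms positive.\<close>

lemma orth_poly_orthogonal:
  assumes "\<And>j. j < n \<Longrightarrow> orth_norm h j \<noteq> 0" and "j < i" "i \<le> n"
  shows "moment_functional h (orth_poly h i * orth_poly h j) = 0"
  using assms(2,3)
proof (induction i arbitrary: j rule: less_induct)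
  case (less i)
  let ?c = "\<lambda>k. moment_functional h (monom 1 i * orth_poly h k) / orth_norm h k"
  have z: "moment_functional h (orth_poly h k * orth_poly h j) = 0" if "k < i" "k \<noteq> j" for k
    using less.IH[of k j] less.IH[of j k] that less.prems by (cases "k < j") (auto simp: mult.commute)
  have "moment_functional h (orth_poly h i * orth_poly h j)
      = moment_functional h (monom 1 i * orth_poly h j)
        - (\<Sum>k<i. ?c k * moment_functional h (orth_poly h k * orth_poly h j))"
    by (subst orth_poly.simps)
      (simp add: left_diff_distrib sum_distrib_right moment_functional_diff moment_functional_sum
        moment_functional_smult)
  also have "(\<Sum>k<i. ?c k * moment_functional h (orth_poly h k * orth_poly h j))
      = (\<Sum>k\<in>{j}. ?c k * moment_functional h (orth_poly h k * orth_poly h j))"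
    using less.prems z by (intro sum.mono_neutral_right) auto
  also have "\<dots> = moment_functional h (monom 1 i * orth_poly h j)"
    using assms(1)[of j] less.prems by simp
  finally show ?case by simp
qed

text \<open>Multiples of orthogonal polynomials are peeled off \<open>q\<close> from the top degree
  down. The case \<open>q = 0\<close> is separate because the zero polynomial has degree 0, which is
  not below \<open>n\<close> when \<open>n = 0\<close>.\<close>

lemma orth_poly_orthogonal_lower_degree:
  assumes nz: "\<And>j. j < n \<Longrightarrow> orth_norm h j \<noteq> 0" and q: "q = 0 \<or> degree q < n"
  shows "moment_functional h (orth_poly h n * q) = 0"
  using q
proof (induction "degree q" arbitrary: q rule: less_induct)
  case less
  show ?case
  proof (cases "q = 0")
    case False
    define m where "m = degree q"
    define r where "r = q - Polynomial.smult (lead_coeff q) (orth_poly h m)"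
    have "degree r \<le> m"
      unfolding r_def by (rule degree_diff_le) (simp_all add: m_def)
    moreover have "coeff r m = 0" by (simp add: r_def m_def)
    ultimately have "r = 0 \<or> degree r < m"
      by (metis leading_coeff_0_iff le_neq_implies_less)
    then have "moment_functional h (orth_poly h n * r) = 0"
      using less.hyps[of r] False less.prems by (cases "r = 0") (auto simp: m_def)
    moreover have "moment_functional h (orth_poly h n * orth_poly h m) = 0"
      using orth_poly_orthogonal[OF nz, of n m n] False less.prems by (auto simp: m_def)
    moreover have "q = r + Polynomial.smult (lead_coeff q) (orth_poly h m)" by (simp add: r_def)
    then have "moment_functional h (orth_poly h n * q) = moment_functional h (orth_poly h n * r)
        + lead_coeff q * moment_functional h (orth_poly h n * orth_poly h m)"
      by (metis distrib_left moment_functional_add moment_functional_smult mult_smult_right)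
    ultimately show ?thesis by simp
  qed simp
qed

text \<open>Pythagoras: for \<open>p = r + c P\<close> with \<open>P\<close> the orthogonal
  polynomial of the same degree, the cross terms vanish, and the square of \<open>c P\<close>
  contributes a positive amount since \<open>c\<close> is the leading coefficient.\<close>

lemma moment_functional_square_pos:
  assumes pos: "\<And>j. orth_norm h j > 0" and "p \<noteq> 0"
  shows "moment_functional h (p * p) > 0"
  using \<open>p \<noteq> 0\<close>
proof (induction "degree p" arbitrary: p rule: less_induct)
  case less
  have nz: "orth_norm h j \<noteq> 0" for j using pos[of j] by simp
  define m where "m = degree p"
  define c where "c = lead_coeff p"
  define r where "r = p - Polynomial.smult c (orth_poly h m)"
  have "degree r \<le> m"
    unfolding r_def by (rule degree_diff_le) (simp_all add: m_def)
  moreover have "coeff r m = 0" by (simp add: r_def m_def c_def)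
  ultimately have r: "r = 0 \<or> degree r < m"
    by (metis leading_coeff_0_iff le_neq_implies_less)
  have "moment_functional h (orth_poly h m * r) = 0"
    using nz r by (intro orth_poly_orthogonal_lower_degree)
  moreover have "moment_functional h (r * r) \<ge> 0"
    using less.hyps[of r] r by (cases "r = 0") (auto simp: m_def intro: less_imp_le)
  moreover have "p * p = r * r + Polynomial.smult c (orth_poly h m * r) + Polynomial.smult c (orth_poly h m * r)
      + Polynomial.smult (c * c) (orth_poly h m * orth_poly h m)"
  proof -
    have p: "p = r + Polynomial.smult c (orth_poly h m)" by (simp add: r_def)
    have "p * p = (r + Polynomial.smult c (orth_poly h m)) * (r + Polynomial.smult c (orth_poly h m))"
      by (rule arg_cong2[where f = "(*)", OF p p])
    then show ?thesis
      by (simp only: distrib_left distrib_right mult_smult_left mult_smult_right smult_smult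
          smult_add_right mult.commute[of r "orth_poly h m"] add.assoc)
  qed
  moreover have "c * c * orth_norm h m > 0"
  proof (rule mult_pos_pos)
    have "c \<noteq> 0" using less.prems by (simp add: c_def)
    then show "c * c > 0" using not_real_square_gt_zero[of c] by blast
  qed (rule pos)
  ultimately show ?case
    by (simp only: moment_functional_add moment_functional_smult mult_zero_right add_0_right)
qed

section \<open>Hankel determinants and positivity on squares\<close>

abbreviation hankel_mat :: "(nat \<Rightarrow> real) \<Rightarrow> nat \<Rightarrow> real Matrix.mat" where
  "hankel_mat h n \<equiv> Matrix.mat n n (\<lambda>(i, j). h (i + j))"

text \<open>The change of basis \<open>T\<close> from monomials to monic orthogonal polynomials is
  triangular with unit diagonal, hence of determinant 1, and turns the Hankel matrix into the
  diagonal matrix of the norms.\<close>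

lemma det_hankel_mat:
  assumes nz: "\<And>j. j < n \<Longrightarrow> orth_norm h j \<noteq> 0"
  shows "Determinant.det (hankel_mat h (Suc n)) = (\<Prod>i\<le>n. orth_norm h i)"
proof -
  let ?N = "Suc n"
  define T where "T = Matrix.mat ?N ?N (\<lambda>(i, j). coeff (orth_poly h i) j)"
  have T: "T \<in> carrier_mat ?N ?N" and H: "hankel_mat h ?N \<in> carrier_mat ?N ?N"
    by (auto simp: T_def)
  have "Determinant.det T = prod_list (diag_mat T)"
    by (rule det_lower_triangular[OF _ T]) (auto simp: T_def coeff_eq_0)
  also have "\<dots> = 1"
    unfolding prod_list_diag_prod by (intro prod.neutral) (auto simp: T_def)
  finally have dT: "Determinant.det T = 1" .
  define X where "X = T * hankel_mat h ?N * transpose_mat T"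
  have X: "X \<in> carrier_mat ?N ?N" by (auto simp: X_def T_def)
  have Xij: "X $$ (i, j) = moment_functional h (orth_poly h i * orth_poly h j)"
    if ij: "i < ?N" "j < ?N" for i j
  proof -
    have "X $$ (i, j) = (\<Sum>b<?N. (\<Sum>a<?N. coeff (orth_poly h i) a * h (a + b)) * coeff (orth_poly h j) b)"
      using ij by (simp add: X_def T_def scalar_prod_def lessThan_atLeast0)
    also have "\<dots> = (\<Sum>b\<le>n. \<Sum>a\<le>n. coeff (orth_poly h i) a * coeff (orth_poly h j) b * h (a + b))"
      by (simp add: sum_distrib_left sum_distrib_right lessThan_Suc_atMost mult_ac)
    also have "\<dots> = moment_functional h (orth_poly h i * orth_poly h j)"
      using ij by (subst moment_functional_mult[of _ n _ n]) (auto intro: sum.swap)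
    finally show ?thesis .
  qed
  have "Determinant.det X = prod_list (diag_mat X)"
    by (rule det_lower_triangular[OF _ X])
      (use Xij orth_poly_orthogonal[OF nz, where n = n] in \<open>auto simp: mult.commute\<close>)
  also have "\<dots> = (\<Prod>i\<le>n. orth_norm h i)"
    unfolding prod_list_diag_prod using X Xij
    by (intro prod.cong) (auto simp: lessThan_Suc_atMost[symmetric] lessThan_atLeast0)
  finally have "Determinant.det X = (\<Prod>i\<le>n. orth_norm h i)" .
  moreover have "Determinant.det X = Determinant.det (hankel_mat h ?N)"
    unfolding X_def using T H
    by (simp add: det_mult[of _ ?N] det_transpose[of T ?N] dT)
  ultimately show ?thesis by simp
qed

text \<open>The determinant of size \<open>n + 1\<close> is the product of the norms up to
  \<open>n\<close>, and the earlier ones are positive by induction.\<close>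

lemma orth_norm_pos:
  assumes "\<And>n. n \<ge> 1 \<Longrightarrow> Determinant.det (hankel_mat h n) > 0"
  shows "orth_norm h n > 0"
proof (induction n rule: less_induct)
  case (less n)
  have "0 < (\<Prod>i\<le>n. orth_norm h i)"
    using det_hankel_mat[of n h] less assms[of "Suc n"] by fastforce
  also have "\<dots> = (\<Prod>i<n. orth_norm h i) * orth_norm h n"
    by (simp add: lessThan_Suc_atMost[symmetric])
  finally have "0 < (\<Prod>i<n. orth_norm h i) * orth_norm h n" .
  moreover have "0 < (\<Prod>i<n. orth_norm h i)" using less by (intro prod_pos) auto
  ultimately show ?case by (simp add: zero_less_mult_iff)
qed

text \<open>Sylvester's criterion for Hankel matrices. It replaces determinants by positivity on
  squares, the form in which measures and quadratures enter.\<close>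

lemma det_hankel_mat_pos_iff:
  "(\<forall>n\<ge>1. Determinant.det (hankel_mat h n) > 0) \<longleftrightarrow>
   (\<forall>p. p \<noteq> 0 \<longrightarrow> moment_functional h (p * p) > 0)"
proof
  assume "\<forall>n\<ge>1. Determinant.det (hankel_mat h n) > 0"
  then show "\<forall>p. p \<noteq> 0 \<longrightarrow> moment_functional h (p * p) > 0"
    using moment_functional_square_pos[of h] orth_norm_pos[of h] by blast
next
  assume pos: "\<forall>p. p \<noteq> 0 \<longrightarrow> moment_functional h (p * p) > 0"
  show "\<forall>n\<ge>1. Determinant.det (hankel_mat h n) > 0"
  proof (intro allI impI)
    fix n :: nat assume "n \<ge> 1"
    then obtain m where n: "n = Suc m" by (cases n) auto
    have "orth_norm h j > 0" for j using pos by simp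
    then show "Determinant.det (hankel_mat h n) > 0"
      unfolding n by (subst det_hankel_mat) (auto intro!: prod_pos simp: less_imp_neq[symmetric])
  qed
qed

section \<open>Gauss quadrature\<close>

lemma map_poly_of_real_add:
  "map_poly (of_real :: real \<Rightarrow> complex) (p + q) = map_poly of_real p + map_poly of_real q"
  by (rule poly_eqI) (simp add: coeff_map_poly)

lemma map_poly_of_real_mult:
  "map_poly (of_real :: real \<Rightarrow> complex) (p * q) = map_poly of_real p * map_poly of_real q"
  by (rule poly_eqI) (simp add: coeff_map_poly coeff_mult)

text \<open>The remainder modulo the quadratic is \<open>u + v x\<close> with real \<open>u\<close>,
  \<open>v\<close>, and it vanishes at the non-real point \<open>a + b i\<close>, so it is
  zero.\<close>

lemma quadratic_dvd_if_complex_root: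
  assumes z: "poly (map_poly of_real q) (Complex a b) = 0" and b: "b \<noteq> 0"
  shows "[:-a, 1:]\<^sup>2 + [:b\<^sup>2:] dvd (q :: real poly)"
proof -
  define s where "s = [:-a, 1:]\<^sup>2 + [:b\<^sup>2:]"
  have s: "s = [:a * a + b * b, -2 * a, 1:]" by (simp add: s_def power2_eq_square)
  define r where "r = q mod s"
  have "degree s = 2" "s \<noteq> 0" by (simp_all add: s)
  then have deg: "degree r < 2" unfolding r_def using degree_mod_less[of s q] by auto
  define u v where "u = coeff r 0" and "v = coeff r 1"
  have r: "r = [:u, v:]"
    by (rule poly_eqI) (use deg in \<open>auto simp: u_def v_def coeff_pCons coeff_eq_0 split: nat.split\<close>)
  have sz: "poly (map_poly of_real s) (Complex a b) = 0"
    unfolding s by (simp add: map_poly_pCons complex_eq_iff algebra_simps)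
  have "(map_poly of_real q :: complex poly) = map_poly of_real (q div s * s + r)"
    by (simp add: r_def)
  also have "\<dots> = map_poly of_real (q div s) * map_poly of_real s + map_poly of_real r"
    by (simp only: map_poly_of_real_add map_poly_of_real_mult)
  finally have "poly (map_poly of_real q) (Complex a b)
      = poly (map_poly of_real (q div s)) (Complex a b) * poly (map_poly of_real s) (Complex a b)
        + poly (map_poly of_real r) (Complex a b)"
    by (simp only: poly_add poly_mult)
  then have "poly (map_poly of_real r) (Complex a b) = 0"
    unfolding z sz by simp
  then have "u = 0 \<and> v = 0" unfolding r using b by (auto simp: map_poly_pCons complex_eq_iff)
  then have "q mod s = 0" using r unfolding r_def by simp
  then show ?thesis unfolding s_def by (simp add: mod_eq_0_iff_dvd)
qed

lemma real_poly_factor: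
  fixes q :: "real poly"
  assumes "degree q > 0"
  shows "(\<exists>a. poly q a = 0) \<or> (\<exists>a b. [:-a, 1:]\<^sup>2 + [:b\<^sup>2:] dvd q)"
proof -
  have "\<not> constant (poly (map_poly (of_real :: real \<Rightarrow> complex) q))"
    using assms by (simp add: constant_degree degree_map_poly)
  then obtain z where z: "poly (map_poly of_real q) z = (0 :: complex)"
    using fundamental_theorem_of_algebra by blast
  show ?thesis
  proof (cases "Im z = 0")
    case True
    then have "z = of_real (Re z)" by (simp add: complex_eq_iff)
    moreover have "poly (map_poly of_real q) (of_real x :: complex) = of_real (poly q x)" for x
      by (induction q) (auto simp: map_poly_pCons)
    ultimately have "poly q (Re z) = 0" using z by (metis of_real_eq_0_iff)
    then show ?thesis by blast
  next
    case False
    then show ?thesis using quadratic_dvd_if_complex_root[of q "Re z" "Im z"] z by auto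
  qed
qed

lemma prod_roots_dvd:
  fixes p :: "real poly"
  assumes "finite S" "\<And>x. x \<in> S \<Longrightarrow> poly p x = 0"
  shows "(\<Prod>x\<in>S. [:-x, 1:]) dvd p"
  using assms
proof (induction S)
  case (insert x S)
  then obtain q where q: "p = (\<Prod>x\<in>S. [:-x, 1:]) * q" by (auto elim: dvdE)
  have "poly (\<Prod>x\<in>S. [:-x, 1:]) x \<noteq> 0" using insert by (auto simp: poly_prod)
  then have "poly q x = 0" using insert.prems[of x] q by auto
  then have "[:-x, 1:] dvd q" by (simp add: poly_eq_0_iff_dvd)
  then show ?case unfolding q using insert
    by (simp add: mult.commute mult_dvd_mono del: mult_pCons_left mult_pCons_right)
qed simp

lemma degree_prod_linear:
  fixes S :: "real set"
  assumes "finite S"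
  shows "degree (\<Prod>x\<in>S. [:-x, 1:]) = card S"
  using assms by (simp add: degree_prod_eq_sum_degree)

section \<open>Zeros of the orthogonal polynomials and Gauss quadrature\<close>

context
  fixes h :: "nat \<Rightarrow> real"
  assumes pos: "\<And>p. p \<noteq> 0 \<Longrightarrow> moment_functional h (p * p) > 0"
begin

lemma orth_poly_orthogonal_pos:
  "q = 0 \<or> degree q < n \<Longrightarrow> moment_functional h (orth_poly h n * q) = 0"
  using pos by (intro orth_poly_orthogonal_lower_degree) (auto simp: less_imp_neq[symmetric])

text \<open>A factorization \<open>P = ((x - a)\<^sup>2 + b\<^sup>2) s\<close> would make \<open>P s\<close> a nonzero sum of squares although
  \<open>P\<close> is orthogonal to \<open>s\<close>.\<close>

lemma not_quadratic_dvd_orth_poly: "\<not> [:-a, 1:]\<^sup>2 + [:b\<^sup>2:] dvd orth_poly h n"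
proof
  assume "[:-a, 1:]\<^sup>2 + [:b\<^sup>2:] dvd orth_poly h n"
  then obtain s where s: "orth_poly h n = ([:-a, 1:]\<^sup>2 + [:b\<^sup>2:]) * s" by (elim dvdE)
  have s0: "s \<noteq> 0" using s orth_poly_nonzero[of h n] by auto
  have "[:-a, 1:]\<^sup>2 + [:b\<^sup>2:] = [:a\<^sup>2 + b\<^sup>2, -2 * a, 1:]" by (simp add: power2_eq_square)
  then have "degree ([:-a, 1:]\<^sup>2 + [:b\<^sup>2:]) = 2" "[:-a, 1:]\<^sup>2 + [:b\<^sup>2:] \<noteq> 0" by simp_all
  then have "n = 2 + degree s" using s s0 degree_mult_eq degree_orth_poly by metis
  then have "moment_functional h (orth_poly h n * s) = 0"
    by (intro orth_poly_orthogonal_pos) simp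
  moreover have "orth_poly h n * s
      = ([:-a, 1:] * s) * ([:-a, 1:] * s) + Polynomial.smult (b\<^sup>2) (s * s)"
  proof -
    have "(Q\<^sup>2 + [:c:]) * t * t = (Q * t) * (Q * t) + Polynomial.smult c (t * t)" for Q t :: "real poly" and c
      by (simp add: power2_eq_square algebra_simps)
    then show ?thesis unfolding s .
  qed
  moreover have "moment_functional h (([:-a, 1:] * s) * ([:-a, 1:] * s)) > 0"
    by (intro pos no_zero_divisors s0) simp
  moreover have "b\<^sup>2 * moment_functional h (s * s) \<ge> 0"
    using pos[OF s0] by simp
  ultimately show False by (simp only: moment_functional_add moment_functional_smult)
qed

text \<open>All zeros are real and simple: a nonconstant cofactor of the product over the distinct
  real zeros would contribute a double zero or a quadratic factor, and neither can divide an
  orthogonal polynomial.\<close>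

lemma orth_poly_eq_prod_roots:
  "orth_poly h n = (\<Prod>x | poly (orth_poly h n) x = 0. [:-x, 1:])"
proof -
  let ?P = "orth_poly h n"
  define S where "S = {x. poly ?P x = 0}"
  have fin: "finite S" unfolding S_def by (rule poly_roots_finite) simp
  define g where "g = (\<Prod>x\<in>S. [:-x, 1:])"
  have "g dvd ?P" unfolding g_def using fin by (rule prod_roots_dvd) (simp add: S_def)
  then obtain q where q: "?P = g * q" by (elim dvdE)
  have "degree q = 0"
  proof (rule ccontr)
    assume "degree q \<noteq> 0"
    then consider a where "poly q a = 0" | a b where "[:-a, 1:]\<^sup>2 + [:b\<^sup>2:] dvd q"
      using real_poly_factor[of q] by auto
    then show False
    proof cases
      case 1
      then have "poly ?P a = 0" unfolding q by simp
      then have "poly g a = 0" unfolding g_def poly_prod using fin by (intro prod_zero) (auto simp: S_def)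
      \<comment> \<open>A root of \<open>q\<close> is already a root of \<open>g\<close>, hence a
        double root of \<open>?P\<close>. This is the excluded quadratic factor with
        \<open>b = 0\<close>.\<close>
      then have "[:-a, 1:] * [:-a, 1:] dvd ?P"
        unfolding q using 1 by (intro mult_dvd_mono) (simp_all add: poly_eq_0_iff_dvd)
      then show False using not_quadratic_dvd_orth_poly[of a 0 n] by (simp add: power2_eq_square)
    next
      case 2
      then show False using not_quadratic_dvd_orth_poly[of a b n] q by auto
    qed
  qed
  then obtain c where c: "q = [:c:]" by (metis degree_eq_zeroE)
  have "lead_coeff g = 1" by (simp add: g_def lead_coeff_prod)
  moreover have "lead_coeff ?P = 1" by simp
  ultimately have "c = 1" using q c by (metis lead_coeff_mult lead_coeff_pCons(2) mult_1)
  then show ?thesis using q c by (simp add: g_def S_def)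
qed

text \<open>The nodes are the \<open>n\<close> zeros of the orthogonal polynomial. Two polynomials
  of degree below \<open>2 * n\<close> that agree at the nodes differ by a multiple
  \<open>?P * q\<close> with \<open>q\<close> of degree below \<open>n\<close>, which the functional
  annihilates.\<close>

lemma gauss_quadrature:
  assumes "n > 0"
  shows "\<exists>(S :: real set) w. finite S \<and> (\<forall>s\<in>S. w s > 0) \<and>
    (\<forall>p. degree p < 2 * n \<longrightarrow> moment_functional h p = (\<Sum>s\<in>S. w s * poly p s))"
proof -
  let ?P = "orth_poly h n"
  define S where "S = {x. poly ?P x = 0}"
  have fin: "finite S" unfolding S_def by (rule poly_roots_finite) simp
  have P: "?P = (\<Prod>x\<in>S. [:-x, 1:])" unfolding S_def by (rule orth_poly_eq_prod_roots)
  have card: "card S = n" using degree_prod_linear[OF fin] P degree_orth_poly[of h n] by simp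
  define l where "l s = (\<Prod>t\<in>S - {s}. [:-t, 1:])" for s
  have l_self: "poly (l s) s \<noteq> 0" if "s \<in> S" for s
    using fin by (auto simp: l_def poly_prod)
  have l_other: "poly (l s) t = 0" if "t \<in> S" "t \<noteq> s" for s t
    using fin that by (auto simp: l_def poly_prod)
  have l_deg: "degree (l s) = n - 1" if "s \<in> S" for s
    unfolding l_def using fin card that by (subst degree_prod_linear) auto
  \<comment> \<open>Testing the formula on \<open>l s * l s\<close>, which vanishes at all other
    nodes, forces this weight and makes its positivity visible.\<close>
  define w where "w s = moment_functional h (l s * l s) / (poly (l s) s)\<^sup>2" for s
  have w: "w s > 0" if "s \<in> S" for s
  proof -
    have "l s \<noteq> 0" using l_self[OF that] by auto
    then show ?thesis using l_self[OF that] pos[of "l s"] by (simp add: w_def)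
  qed
  have quad: "moment_functional h p = (\<Sum>s\<in>S. w s * poly p s)" if p: "degree p < 2 * n" for p
  proof -
    \<comment> \<open>Interpolates \<open>p\<close> at the nodes by squares of Lagrange products, so
      that the functional of \<open>r\<close> is the quadrature sum by the choice of
      \<open>w\<close>.\<close>
    define r where "r = (\<Sum>s\<in>S. Polynomial.smult (poly p s / (poly (l s) s)\<^sup>2) (l s * l s))"
    have "degree r \<le> 2 * (n - 1)"
      unfolding r_def
    proof (rule degree_sum_le[OF fin])
      fix s assume "s \<in> S"
      then have "degree (l s * l s) \<le> 2 * (n - 1)" using degree_mult_le[of "l s" "l s"] l_deg by simp
      then show "degree (Polynomial.smult (poly p s / (poly (l s) s)\<^sup>2) (l s * l s)) \<le> 2 * (n - 1)"
        using degree_smult_le le_trans by blast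
    qed
    then have "degree r \<le> 2 * n - 1" using \<open>n > 0\<close> by linarith
    then have dpr: "degree (p - r) \<le> 2 * n - 1" using p by (intro degree_diff_le) auto
    have "poly (p - r) t = 0" if t: "t \<in> S" for t
    proof -
      have "poly r t = (\<Sum>s\<in>S. poly p s / (poly (l s) s)\<^sup>2 * (poly (l s) t * poly (l s) t))"
        by (simp add: r_def poly_sum)
      also have "\<dots> = (\<Sum>s\<in>{t}. poly p s / (poly (l s) s)\<^sup>2 * (poly (l s) t * poly (l s) t))"
        using fin t l_other by (intro sum.mono_neutral_right) auto
      finally show ?thesis using l_self[OF t] by (simp add: power2_eq_square)
    qed
    then have "?P dvd p - r" unfolding P by (intro prod_roots_dvd fin)
    then obtain q where q: "p - r = ?P * q" by (elim dvdE)
    have "q = 0 \<or> degree q < n"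
    proof (cases "q = 0")
      case False
      then have "degree (p - r) = n + degree q" using degree_mult_eq[of ?P q] by (simp add: q)
      then show ?thesis using dpr \<open>n > 0\<close> by linarith
    qed simp
    then have "moment_functional h (p - r) = 0"
      unfolding q by (rule orth_poly_orthogonal_pos)
    then have "moment_functional h p = moment_functional h r"
      by (simp add: moment_functional_diff)
    also have "\<dots> = (\<Sum>s\<in>S. w s * poly p s)"
      by (simp add: r_def moment_functional_sum moment_functional_smult w_def mult.commute)
    finally show ?thesis .
  qed
  show ?thesis using fin w quad by blast
qed

end

section \<open>Hamburger's moment problem\<close>

text \<open>A bounded continuous substitute for the identity: weak convergence applies to its powers
  but not directly to \<open>x ^ k\<close>.\<close>

definition clamp_real :: "real \<Rightarrow> real \<Rightarrow> real" where
  "clamp_real R x = max (-R) (min R x)"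

lemma clamp_real_abs_le: "R \<ge> 0 \<Longrightarrow> \<bar>clamp_real R x\<bar> \<le> R" "R \<ge> 0 \<Longrightarrow> \<bar>clamp_real R x\<bar> \<le> \<bar>x\<bar>"
  by (auto simp: clamp_real_def)

lemma isCont_clamp_real: "isCont (clamp_real R) x"
  unfolding clamp_real_def by (intro continuous_intros)

lemma borel_measurable_clamp_real [measurable]: "clamp_real R \<in> borel_measurable borel"
  by (intro borel_measurable_continuous_onI continuous_at_imp_continuous_on ballI isCont_clamp_real)

text \<open>For \<open>\<bar>x\<bar> > R\<close> the error is at most
  \<open>\<bar>x\<bar> ^ k\<close>, and each of \<open>k + 2\<close> further factors
  \<open>\<bar>x\<bar> / R\<close> exceeds 1. The resulting exponent is even, so the bound
  integrates to a moment without absolute values.\<close>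

lemma clamp_real_power_error:
  assumes "R > 0"
  shows "\<bar>x ^ k - clamp_real R x ^ k\<bar> \<le> x ^ (2 * k + 2) / R ^ (k + 2)"
proof (cases "\<bar>x\<bar> \<le> R")
  case True
  then have "clamp_real R x = x" by (auto simp: clamp_real_def)
  moreover have "0 \<le> x ^ (2 * k + 2) / R ^ (k + 2)"
    using assms by (intro divide_nonneg_pos zero_le_even_power) auto
  ultimately show ?thesis by simp
next
  case False
  have le: "\<bar>x ^ k - clamp_real R x ^ k\<bar> \<le> \<bar>x\<bar> ^ k"
  proof (cases "x > 0")
    case True
    then have c: "clamp_real R x = R" using False assms by (auto simp: clamp_real_def)
    have "0 \<le> R ^ k" "R ^ k \<le> x ^ k" using True False assms by (auto intro: power_mono)
    then show ?thesis using True by (simp add: c)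
  next
    case x: False
    then have c: "clamp_real R x = - R" using False assms by (auto simp: clamp_real_def)
    have "0 \<le> R ^ k" "R ^ k \<le> (-x) ^ k" using x False assms by (auto intro: power_mono)
    moreover have "x ^ k - (- R) ^ k = (-1) ^ k * ((-x) ^ k - R ^ k)"
      by (simp add: right_diff_distrib power_mult_distrib[symmetric])
    ultimately show ?thesis using x by (simp add: c abs_mult)
  qed
  have "\<bar>x ^ k - clamp_real R x ^ k\<bar> * R ^ (k + 2) \<le> \<bar>x\<bar> ^ k * R ^ (k + 2)"
    using le assms by (intro mult_right_mono) auto
  also have "\<bar>x\<bar> ^ k * R ^ (k + 2) \<le> \<bar>x\<bar> ^ k * \<bar>x\<bar> ^ (k + 2)"
    using False assms by (intro mult_left_mono power_mono) auto
  also have "\<bar>x\<bar> ^ k * \<bar>x\<bar> ^ (k + 2) = \<bar>x\<bar> ^ (2 * k + 2)"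
    unfolding power_add[symmetric] by (simp add: mult_2)
  finally have "\<bar>x ^ k - clamp_real R x ^ k\<bar> \<le> \<bar>x\<bar> ^ (2 * k + 2) / R ^ (k + 2)"
    using assms by (simp add: pos_le_divide_eq del: power_Suc)
  also have "\<bar>x\<bar> ^ (2 * k + 2) = x ^ (2 * k + 2)"
    by (rule power_even_abs) simp
  finally show ?thesis .
qed

lemma (in real_distribution) integrable_clamp_power: "R \<ge> 0 \<Longrightarrow> integrable M (\<lambda>x. clamp_real R x ^ k)"
  by (rule integrable_const_bound[where B = "R ^ k"])
    (auto simp: power_abs intro!: power_mono clamp_real_abs_le)

text \<open>The bound depends on the measure only through one even moment, hence is uniform along a
  sequence on which that moment is constant.\<close>

lemma (in real_distribution) clamp_moment_error:
  assumes R: "R > 0" and int: "\<And>j. integrable M (\<lambda>x. x ^ j)"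
  shows "\<bar>(\<integral>x. x ^ k \<partial>M) - (\<integral>x. clamp_real R x ^ k \<partial>M)\<bar> \<le> (\<integral>x. x ^ (2 * k + 2) \<partial>M) / R ^ (k + 2)"
proof -
  have c: "integrable M (\<lambda>x. clamp_real R x ^ k)" using R by (intro integrable_clamp_power) simp
  have "(\<integral>x. x ^ k \<partial>M) - (\<integral>x. clamp_real R x ^ k \<partial>M) = (\<integral>x. x ^ k - clamp_real R x ^ k \<partial>M)"
    using int[of k] c by simp
  also have "\<bar>\<dots>\<bar> \<le> (\<integral>x. \<bar>x ^ k - clamp_real R x ^ k\<bar> \<partial>M)"
    by (rule integral_abs_bound)
  also have "\<dots> \<le> (\<integral>x. x ^ (2 * k + 2) / R ^ (k + 2) \<partial>M)"
    by (intro integral_mono integrable_divide_zero integrable_abs Bochner_Integration.integrable_diff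
        int c clamp_real_power_error R)
  finally show ?thesis by simp
qed

lemma moment_convergence:
  fixes \<mu> :: "nat \<Rightarrow> real measure"
  assumes \<mu>: "\<And>n. real_distribution (\<mu> n)" and M: "real_distribution M" and wc: "weak_conv_m \<mu> M"
    and int: "\<And>n k. integrable (\<mu> n) (\<lambda>x. x ^ k)"
    and mom: "\<And>k. \<forall>\<^sub>F n in sequentially. (\<integral>x. x ^ k \<partial>\<mu> n) = h k"
  shows "integrable M (\<lambda>x. x ^ k)" "(\<integral>x. x ^ k \<partial>M) = h k"
proof -
  interpret M: real_distribution M by (rule M)
  have lim: "(\<lambda>n. \<integral>x. clamp_real R x ^ k \<partial>\<mu> n) \<longlonglongrightarrow> (\<integral>x. clamp_real R x ^ k \<partial>M)" if "R \<ge> 0" for R k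
    using that
    by (intro weak_conv_imp_integral_bdd_continuous_conv[OF \<mu> M wc, where B = "R ^ k"])
      (auto simp: power_abs intro!: power_mono clamp_real_abs_le continuous_intros isCont_clamp_real)
  \<comment> \<open>Clamped even powers increase with the clamping level, and their integrals under
    \<open>M\<close> are limits of quantities at most \<open>h (2 * k)\<close>. Monotone convergence
    then gives integrability and an inequality, enough to control the clamping error under
    \<open>M\<close>.\<close>
  have even: "integrable M (\<lambda>x. x ^ (2 * k)) \<and> (\<integral>x. x ^ (2 * k) \<partial>M) \<le> h (2 * k)" for k
  proof -
    have le: "(\<integral>x. clamp_real (real i) x ^ (2 * k) \<partial>M) \<le> h (2 * k)" for i
    proof (rule tendsto_upperbound[OF lim])
      show "\<forall>\<^sub>F n in sequentially. (\<integral>x. clamp_real (real i) x ^ (2 * k) \<partial>\<mu> n) \<le> h (2 * k)"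
        using mom[of "2 * k"]
      proof eventually_elim
        case (elim n)
        interpret N: real_distribution "\<mu> n" by (rule \<mu>)
        have "(\<integral>x. clamp_real (real i) x ^ (2 * k) \<partial>\<mu> n) \<le> (\<integral>x. x ^ (2 * k) \<partial>\<mu> n)"
          using power_mono[OF clamp_real_abs_le(2)[of "real i"], of _ "2 * k"]
          by (intro integral_mono N.integrable_clamp_power int) (auto simp: power_even_abs)
        then show ?case using elim by simp
      qed
    qed auto
    have mono: "clamp_real (real i) x ^ (2 * k) \<le> clamp_real (real j) x ^ (2 * k)" if "i \<le> j" for i j x
    proof -
      have "\<bar>clamp_real (real i) x\<bar> \<le> \<bar>clamp_real (real j) x\<bar>"
        using that by (auto simp: clamp_real_def)
      then have "\<bar>clamp_real (real i) x\<bar> ^ (2 * k) \<le> \<bar>clamp_real (real j) x\<bar> ^ (2 * k)"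
        by (rule power_mono) simp
      then show ?thesis by (simp add: power_even_abs)
    qed
    have "incseq (\<lambda>i. \<integral>x. clamp_real (real i) x ^ (2 * k) \<partial>M)"
      unfolding incseq_def using mono by (intro allI impI integral_mono M.integrable_clamp_power) auto
    then obtain L where L: "(\<lambda>i. \<integral>x. clamp_real (real i) x ^ (2 * k) \<partial>M) \<longlonglongrightarrow> L"
      using incseq_convergent[of _ "h (2 * k)"] le by blast
    have ptw: "(\<lambda>i. clamp_real (real i) x ^ (2 * k)) \<longlonglongrightarrow> x ^ (2 * k)" for x
    proof -
      obtain m where m: "real m > \<bar>x\<bar>" using reals_Archimedean2 by blast
      have "clamp_real (real i) x = x" if "i \<ge> m" for i
      proof -
        have "real m \<le> real i" using that by simp
        then show ?thesis using m by (auto simp: clamp_real_def)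
      qed
      then have "\<forall>\<^sub>F i in sequentially. clamp_real (real i) x ^ (2 * k) = x ^ (2 * k)"
        unfolding eventually_sequentially by metis
      then show ?thesis by (rule tendsto_eventually)
    qed
    have "integrable M (\<lambda>x. x ^ (2 * k))" "(\<integral>x. x ^ (2 * k) \<partial>M) = L"
      using integrable_monotone_convergence[OF _ _ _ L, of "\<lambda>x. x ^ (2 * k)"]
        integral_monotone_convergence[OF _ _ _ L, of "\<lambda>x. x ^ (2 * k)"]
        ptw mono M.integrable_clamp_power by (auto simp: mono_def)
    moreover have "L \<le> h (2 * k)" using L le by (intro LIMSEQ_le_const2) auto
    ultimately show ?thesis by simp
  qed
  have intM: "integrable M (\<lambda>x. x ^ k)" for k
  proof (rule Bochner_Integration.integrable_bound)
    show "integrable M (\<lambda>x. 1 + x ^ (2 * k))" using even[of k] by simp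
    have "\<bar>x ^ k\<bar> \<le> 1 + x ^ (2 * k)" for x :: real
    proof -
      have "2 * \<bar>x ^ k\<bar> \<le> 1 + (\<bar>x ^ k\<bar>)\<^sup>2"
        using zero_le_power2[of "1 - \<bar>x ^ k\<bar>"] by (simp add: power2_diff)
      then show ?thesis by (simp add: power_mult[symmetric] mult.commute)
    qed
    then show "AE x in M. norm (x ^ k) \<le> norm (1 + x ^ (2 * k))"
      by (intro AE_I2) (auto intro: order_trans[OF _ abs_ge_self])
  qed simp
  then show "integrable M (\<lambda>x. x ^ k)" .
  define C where "C = h (2 * (k + 1))"
  have "0 \<le> (\<integral>x. x ^ (2 * (k + 1)) \<partial>M)"
    by (intro Bochner_Integration.integral_nonneg zero_le_even_power) simp
  also have "\<dots> \<le> C"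
    unfolding C_def using even by blast
  finally have C: "C \<ge> 0" .
  \<comment> \<open>Both \<open>h k\<close> and the moment of \<open>M\<close> are compared with the
    clamped integral under \<open>M\<close>. Each comparison costs at most \<open>D\<close>, because
    the moments of order \<open>2 * k + 2\<close> involved are bounded by \<open>C\<close>.\<close>
  have bound: "\<bar>(\<integral>x. x ^ k \<partial>M) - h k\<bar> \<le> 2 * C / R" if R: "R \<ge> 1" for R
  proof -
    define D where "D = C / R ^ (k + 2)"
    have M1: "\<bar>(\<integral>x. x ^ k \<partial>M) - (\<integral>x. clamp_real R x ^ k \<partial>M)\<bar> \<le> D"
    proof -
      have "\<bar>(\<integral>x. x ^ k \<partial>M) - (\<integral>x. clamp_real R x ^ k \<partial>M)\<bar> \<le> (\<integral>x. x ^ (2 * k + 2) \<partial>M) / R ^ (k + 2)"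
        using M.clamp_moment_error[OF _ intM, of R] R by simp
      also have "\<dots> \<le> D"
        unfolding D_def C_def using even[of "k + 1"] R by (intro divide_right_mono) auto
      finally show ?thesis .
    qed
    have M2: "\<bar>h k - (\<integral>x. clamp_real R x ^ k \<partial>M)\<bar> \<le> D"
    proof (rule tendsto_upperbound)
      show "(\<lambda>n. \<bar>h k - (\<integral>x. clamp_real R x ^ k \<partial>\<mu> n)\<bar>) \<longlonglongrightarrow> \<bar>h k - (\<integral>x. clamp_real R x ^ k \<partial>M)\<bar>"
        using R by (intro tendsto_intros lim) auto
      show "\<forall>\<^sub>F n in sequentially. \<bar>h k - (\<integral>x. clamp_real R x ^ k \<partial>\<mu> n)\<bar> \<le> D"
        using mom[of k] mom[of "2 * k + 2"]
      proof eventually_elim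
        case (elim n)
        then show ?case
          using real_distribution.clamp_moment_error[OF \<mu> _ int, of R n k] R by (simp add: D_def C_def)
      qed
    qed auto
    have "D \<le> C / R"
      unfolding D_def using R C self_le_power[of R "k + 2"] by (intro divide_left_mono) auto
    then show ?thesis using M1 M2 by linarith
  qed
  show "(\<integral>x. x ^ k \<partial>M) = h k"
  proof (rule ccontr)
    assume "(\<integral>x. x ^ k \<partial>M) \<noteq> h k"
    define e where "e = \<bar>(\<integral>x. x ^ k \<partial>M) - h k\<bar>"
    have e: "e > 0" using \<open>_ \<noteq> h k\<close> by (simp add: e_def)
    \<comment> \<open>At \<open>R = 1 + 2 * C / e\<close> the bound equals
      \<open>2 * C * e / (e + 2 * C)\<close>, which is strictly below \<open>e\<close>, also when
      \<open>C = 0\<close>.\<close>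
    have "e \<le> 2 * C / (1 + 2 * C / e)"
      unfolding e_def[symmetric] using bound[of "1 + 2 * C / e"] C e by (simp add: e_def)
    then show False using e C mult_pos_pos[OF e e] by (simp add: field_simps)
  qed
qed

section \<open>Existence of a representing measure\<close>

lemma quadrature_distribution:
  assumes pos: "\<And>p. p \<noteq> 0 \<Longrightarrow> moment_functional h (p * p) > 0" and "h 0 = 1" and n: "n > 0"
  obtains N where "real_distribution N" "\<And>k. integrable N (\<lambda>x. x ^ k)"
    "\<And>k. k < 2 * n \<Longrightarrow> (\<integral>x. x ^ k \<partial>N) = h k"
proof -
  obtain S w where S: "finite S" and w: "\<And>s. s \<in> S \<Longrightarrow> w s > 0"
    and quad: "\<And>p. degree p < 2 * n \<Longrightarrow> moment_functional h p = (\<Sum>s\<in>S. w s * poly p s)"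
    using gauss_quadrature[OF pos n] by blast
  have w0: "0 \<le> w s" if "s \<in> S" for s using w[OF that] by simp
  have mom: "(\<Sum>s\<in>S. w s * s ^ k) = h k" if "k < 2 * n" for k
  proof -
    have "degree (monom (1::real) k) < 2 * n" using that by (simp add: degree_monom_eq)
    from quad[OF this] show ?thesis by (simp add: poly_monom)
  qed
  \<comment> \<open>\<open>point_measure\<close> lives on the subsets of \<open>S\<close>; the
    push-forward along the identity makes it a Borel measure on the line. Its total mass is
    \<open>h 0 = 1\<close>.\<close>
  define Q where "Q = point_measure S w"
  define N where "N = distr Q borel (\<lambda>x. x)"
  have meas: "(\<lambda>x. x) \<in> measurable Q borel" using S by (simp add: Q_def)
  have "prob_space Q"
    unfolding Q_def using mom[of 0] n \<open>h 0 = 1\<close> sum_ennreal[of S w] w0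
    by (intro prob_space_point_measure S) simp_all
  then have "prob_space N" unfolding N_def by (rule prob_space.prob_space_distr[OF _ meas])
  then have "real_distribution N"
    by (intro real_distribution.intro real_distribution_axioms.intro) (simp_all add: N_def)
  moreover have "integrable N (\<lambda>x. x ^ k)" for k
    unfolding N_def using S by (subst integrable_distr_eq[OF meas]) (auto simp: Q_def integrable_point_measure_finite)
  moreover have "(\<integral>x. x ^ k \<partial>N) = h k" if "k < 2 * n" for k
  proof -
    have "(\<integral>x. x ^ k \<partial>N) = (\<integral>x. x ^ k \<partial>Q)"
      unfolding N_def by (rule integral_distr[OF meas]) simp
    also have "\<dots> = (\<Sum>s\<in>S. w s * s ^ k)"
      unfolding Q_def by (subst lebesgue_integral_point_measure_finite[OF S w0]) auto
    finally show ?thesis using mom[OF that] by simp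
  qed
  ultimately show thesis by (rule that)
qed

lemma hamburger_normalized:
  assumes pos: "\<And>p. p \<noteq> 0 \<Longrightarrow> moment_functional h (p * p) > 0" and h0: "h 0 = 1"
  shows "\<exists>M. real_distribution M \<and> (\<forall>k. integrable M (\<lambda>x. x ^ k)) \<and> (\<forall>k. (\<integral>x. x ^ k \<partial>M) = h k)"
proof -
  \<comment> \<open>With \<open>n + 2\<close> nodes the second moment is exact for every
    \<open>n\<close>, including 0, as the tightness argument requires.\<close>
  have "\<forall>n. \<exists>N. real_distribution N \<and> (\<forall>k. integrable N (\<lambda>x. x ^ k)) \<and>
      (\<forall>k < 2 * (n + 2). (\<integral>x. x ^ k \<partial>N) = h k)"
  proof
    fix n :: nat
    show "\<exists>N. real_distribution N \<and> (\<forall>k. integrable N (\<lambda>x. x ^ k)) \<and>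
      (\<forall>k < 2 * (n + 2). (\<integral>x. x ^ k \<partial>N) = h k)"
      by (rule quadrature_distribution[OF pos h0, of "n + 2"]) auto
  qed
  then obtain \<mu> where \<mu>: "\<And>n. real_distribution (\<mu> n)"
    and int: "\<And>n k. integrable (\<mu> n) (\<lambda>x. x ^ k)"
    and mom: "\<And>n k. k < 2 * (n + 2) \<Longrightarrow> (\<integral>x. x ^ k \<partial>\<mu> n) = h k"
    by metis
  have h2: "h 2 \<ge> 0"
  proof -
    have "0 \<le> (\<integral>x. x ^ 2 \<partial>\<mu> 0)" by (intro Bochner_Integration.integral_nonneg) simp
    then show ?thesis using mom[of 2 0] by simp
  qed
  have "tight \<mu>"
    unfolding tight_def
  proof (intro conjI allI impI \<mu>)
    fix \<epsilon> :: real assume \<epsilon>: "\<epsilon> > 0"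
    \<comment> \<open>Chosen so that \<open>R\<^sup>2 \<ge> R > h 2 / \<epsilon>\<close>;
      Chebyshev's inequality then leaves mass below \<open>\<epsilon>\<close> outside the interval,
      uniformly in \<open>n\<close>.\<close>
    define R where "R = 1 + h 2 / \<epsilon>"
    have R: "R \<ge> 1" using h2 \<epsilon> by (simp add: R_def)
    have "h 2 / \<epsilon> < R" by (simp add: R_def)
    also have "R \<le> R\<^sup>2" using R by (rule self_le_power) simp
    finally have small: "h 2 / R\<^sup>2 < \<epsilon>" using \<epsilon> R by (simp add: field_simps)
    have "measure (\<mu> n) {-R<..R} > 1 - \<epsilon>" for n
    proof -
      interpret N: real_distribution "\<mu> n" by (rule \<mu>)
      have "measure (\<mu> n) (UNIV - {-R<..R}) \<le> measure (\<mu> n) {x \<in> space (\<mu> n). \<bar>x\<bar> \<ge> R}"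
        by (rule N.finite_measure_mono) auto
      also have "\<dots> \<le> (\<integral>x. x ^ 2 \<partial>\<mu> n) / R\<^sup>2"
        using R int[of n 2] by (intro N.second_moment_method) auto
      also have "\<dots> < \<epsilon>" using mom[of 2 n] small by simp
      finally show ?thesis using N.prob_compl[of "{-R<..R}"] by simp
    qed
    then show "\<exists>a b. a < b \<and> (\<forall>n. 1 - \<epsilon> < measure (\<mu> n) {a<..b})"
      using R by (intro exI[of _ "-R"] exI[of _ R]) auto
  qed
  then obtain r M where r: "strict_mono (r :: nat \<Rightarrow> nat)" and M: "real_distribution M"
    and wc: "weak_conv_m (\<mu> \<circ> id \<circ> r) M"
    using tight_imp_convergent_subsubsequence[of \<mu> id] by (auto simp: strict_mono_def)
  have ev: "\<forall>\<^sub>F n in sequentially. (\<integral>x. x ^ k \<partial>(\<mu> \<circ> id \<circ> r) n) = h k" for k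
    using eventually_ge_at_top[of k]
  proof eventually_elim
    case (elim n)
    then have "k \<le> r n" using strict_mono_imp_increasing[OF r, of n] by simp
    then show ?case using mom[of k "r n"] by simp
  qed
  have 1: "real_distribution ((\<mu> \<circ> id \<circ> r) n)" "integrable ((\<mu> \<circ> id \<circ> r) n) (\<lambda>x. x ^ k)" for n k
    using \<mu> int by simp_all
  show ?thesis
    using M moment_convergence[OF 1(1) M wc 1(2) ev] by blast
qed

text \<open>\<open>h 0\<close> is the value of the functional at the square of 1, hence positive.
  The normalized sequence has a representing probability measure, which is scaled back by the
  constant density \<open>h 0\<close>.\<close>

theorem hamburger_moment_problem:
  assumes pos: "\<And>p. p \<noteq> 0 \<Longrightarrow> moment_functional h (p * p) > 0"
  obtains M :: "real measure" where "sets M = sets borel" "finite_measure M"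
    "\<And>k. integrable M (\<lambda>x. x ^ k)" "\<And>k. (\<integral>x. x ^ k \<partial>M) = h k"
proof -
  have "moment_functional h (1 * 1) > 0" by (rule pos) simp
  then have h0: "h 0 > 0" by (simp add: moment_functional_def)
  have "moment_functional (\<lambda>i. h i / h 0) p = moment_functional h p / h 0" for p
    by (simp add: moment_functional_def sum_divide_distrib)
  then have pos': "p \<noteq> 0 \<Longrightarrow> moment_functional (\<lambda>i. h i / h 0) (p * p) > 0" for p
    using pos h0 by simp
  have one: "h 0 / h 0 = 1" using h0 by simp
  obtain N where N: "real_distribution N" and int: "\<And>k. integrable N (\<lambda>x. x ^ k)"
    and mom: "\<And>k. (\<integral>x. x ^ k \<partial>N) = h k / h 0"
    using hamburger_normalized[of "\<lambda>i. h i / h 0", OF pos' one] by blast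
  interpret N: real_distribution N by (rule N)
  define M where "M = density N (\<lambda>_. ennreal (h 0))"
  have "sets M = sets borel" by (simp add: M_def)
  moreover have "finite_measure M"
    by (rule finite_measureI) (simp add: M_def emeasure_density_const N.emeasure_space_1 ennreal_mult_eq_top_iff)
  moreover have "integrable M (\<lambda>x. x ^ k)" for k
    unfolding M_def using h0 int by (subst integrable_density) auto
  moreover have "(\<integral>x. x ^ k \<partial>M) = h k" for k
    unfolding M_def using h0 mom by (subst integral_density) auto
  ultimately show thesis by (rule that)
qed

section \<open>Polynomial integrals and the support of a measure\<close>

lemma integral_poly_moments:
  assumes "\<And>k. integrable M (\<lambda>x. x ^ k)"
  shows "integrable M (poly p)" "(\<integral>x. poly p x \<partial>M) = moment_functional (\<lambda>k. \<integral>x. x ^ k \<partial>M) p"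
proof -
  have "poly p = (\<lambda>x. \<Sum>i\<le>degree p. coeff p i * x ^ i)" by (rule ext) (rule poly_altdef)
  then show "integrable M (poly p)" "(\<integral>x. poly p x \<partial>M) = moment_functional (\<lambda>k. \<integral>x. x ^ k \<partial>M) p"
    using assms by (simp_all add: moment_functional_def)
qed

text \<open>A zero integral makes \<open>p\<close> vanish almost everywhere. But some support point
  is not among the finitely many roots, and it lies in the open set where \<open>p\<close> is
  nonzero, which therefore has positive measure.\<close>

lemma integral_square_pos_if_infinite_support:
  assumes M: "sets M = sets borel" and supp: "infinite (measure_support M)"
    and int: "integrable M (\<lambda>x. (poly p x)\<^sup>2)" and "p \<noteq> 0"
  shows "(\<integral>x. (poly p x)\<^sup>2 \<partial>M) > 0"
proof (rule ccontr)
  assume "\<not> (\<integral>x. (poly p x)\<^sup>2 \<partial>M) > 0"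
  moreover have "(\<integral>x. (poly p x)\<^sup>2 \<partial>M) \<ge> 0" by (intro Bochner_Integration.integral_nonneg) simp
  ultimately have "(\<integral>x. (poly p x)\<^sup>2 \<partial>M) = 0" by simp
  then have AE: "AE x in M. poly p x = 0"
    using int by (subst (asm) integral_nonneg_eq_0_iff_AE) auto
  have "\<not> measure_support M \<subseteq> {x. poly p x = 0}"
    using supp poly_roots_finite[OF \<open>p \<noteq> 0\<close>] finite_subset by blast
  then obtain x where x: "x \<in> measure_support M" "poly p x \<noteq> 0" by blast
  have op: "open {x. poly p x \<noteq> 0}"
    by (intro open_Collect_neq continuous_intros)
  then have "emeasure M {x. poly p x \<noteq> 0} > 0" using x by (simp add: measure_support_def)
  moreover have "space M = UNIV" using sets_eq_imp_space_eq[OF M] by simp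
  then have "emeasure M {x. poly p x \<noteq> 0} = 0"
    using AE_iff_measurable[of "{x. poly p x \<noteq> 0}" M "\<lambda>x. poly p x = 0"] AE op M by auto
  ultimately show False by simp
qed

text \<open>The complement of the support is the union of all open null sets; by Lindelof countably
  many of them cover it, so it is a null set.\<close>

lemma AE_measure_support:
  assumes M: "sets M = sets borel"
  shows "AE x in M. x \<in> measure_support M"
proof -
  define \<F> where "\<F> = {U :: real set. open U \<and> emeasure M U = 0}"
  obtain \<F>' where F: "\<F>' \<subseteq> \<F>" "countable \<F>'" "\<Union>\<F>' = \<Union>\<F>"
    using Lindelof[of \<F>] by (auto simp: \<F>_def)
  have "(\<Union>U\<in>\<F>'. U) \<in> null_sets M"
    using F M by (intro null_sets_UN') (auto simp: \<F>_def null_sets_def)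
  moreover have "{x \<in> space M. x \<notin> measure_support M} \<subseteq> (\<Union>U\<in>\<F>'. U)"
    using F(3) by (auto simp: measure_support_def \<F>_def)
  ultimately show ?thesis by (intro AE_I'[of _ M])
qed

text \<open>On a finite support, the product of the linear factors at its points is a nonzero
  polynomial that vanishes almost everywhere.\<close>

lemma infinite_support_if_square_pos:
  assumes M: "sets M = sets borel"
    and pos: "\<And>p. p \<noteq> 0 \<Longrightarrow> (\<integral>x. (poly p x)\<^sup>2 \<partial>M) > 0"
  shows "infinite (measure_support M)"
proof
  assume fin: "finite (measure_support M)"
  define p where "p = (\<Prod>s\<in>measure_support M. [:-s, 1:])"
  have "(poly p x)\<^sup>2 = 0" if "x \<in> measure_support M" for x
    using fin that by (auto simp: p_def poly_prod)
  then have "(\<integral>x. (poly p x)\<^sup>2 \<partial>M) = 0"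
    using AE_measure_support[OF M] by (intro integral_eq_zero_AE) (auto elim: eventually_mono)
  moreover have "p \<noteq> 0" using fin by (simp add: p_def)
  ultimately show False using pos[of p] by simp
qed

section \<open>Sobolev inner products\<close>

text \<open>The coefficient is the same falling factorial as in \<open>sobolev_term_nth\<close>; it
  vanishes whenever the exponent \<open>i - k\<close> is truncated.\<close>

lemma higher_pderiv_monom_prod:
  "(pderiv ^^ k) (monom (c::real) i) = monom (c * (\<Prod>t<k. real i - real t)) (i - k)"
proof (induction k)
  case (Suc k)
  have "real (i - k) * (\<Prod>t<k. real i - real t) = (real i - real k) * (\<Prod>t<k. real i - real t)"
    unfolding prod_diff_eq_fact_quotient by (simp add: of_nat_diff)
  then have "real (i - k) * (c * (\<Prod>t<k. real i - real t)) = c * (\<Prod>t<Suc k. real i - real t)"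
    by (simp add: mult_ac)
  then show ?case by (simp add: Suc.IH pderiv_monom)
qed simp

lemma higher_pderiv_as_sum:
  fixes p :: "real poly"
  shows "(pderiv ^^ k) p = (\<Sum>i\<le>degree p. monom (coeff p i * (\<Prod>t<k. real i - real t)) (i - k))"
proof -
  have "(pderiv ^^ k) p = (pderiv ^^ k) (\<Sum>i\<le>degree p. monom (coeff p i) i)"
    by (simp only: poly_as_sum_of_monoms)
  then show ?thesis by (simp only: higher_pderiv_sum higher_pderiv_monom_prod)
qed

lemma sobolev_inner_eq_sum:
  assumes "\<And>k. k \<le> d \<Longrightarrow> (\<forall>n. integrable (\<mu> k) (\<lambda>x. x ^ n))"
    and H: "\<And>k i j. k \<le> d \<Longrightarrow> H k i j = (\<integral>x. x ^ (i + j) \<partial>\<mu> k)"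
  shows "sobolev_inner d \<mu> p q = (\<Sum>i\<le>degree p. \<Sum>j\<le>degree q.
     coeff p i * (\<Sum>k\<le>d. sobolev_term k (H k) i j) * coeff q j)"
proof -
  have "(\<integral>x. poly ((pderiv ^^ k) p) x * poly ((pderiv ^^ k) q) x \<partial>\<mu> k)
      = (\<Sum>i\<le>degree p. \<Sum>j\<le>degree q. coeff p i * sobolev_term k (H k) i j * coeff q j)"
    if k: "k \<le> d" for k
  proof -
    let ?L = "moment_functional (\<lambda>n. \<integral>x. x ^ n \<partial>\<mu> k)"
    have "(\<lambda>x. poly ((pderiv ^^ k) p) x * poly ((pderiv ^^ k) q) x)
        = poly ((pderiv ^^ k) p * (pderiv ^^ k) q)" by (rule ext) simp
    then have "(\<integral>x. poly ((pderiv ^^ k) p) x * poly ((pderiv ^^ k) q) x \<partial>\<mu> k)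
        = ?L ((pderiv ^^ k) p * (pderiv ^^ k) q)"
      using integral_poly_moments(2)[of "\<mu> k"] assms(1)[OF k] by simp
    also have "\<dots> = (\<Sum>i\<le>degree p. \<Sum>j\<le>degree q.
        coeff p i * (\<Prod>t<k. real i - real t) * (coeff q j * (\<Prod>t<k. real j - real t))
        * (\<integral>x. x ^ (i - k + (j - k)) \<partial>\<mu> k))"
      unfolding higher_pderiv_as_sum[of k p] higher_pderiv_as_sum[of k q] sum_product
      by (simp only: mult_monom moment_functional_sum moment_functional_monom)
    finally show ?thesis by (simp add: sobolev_term_nth H[OF k] mult_ac)
  qed
  then have "sobolev_inner d \<mu> p q = (\<Sum>k\<le>d. \<Sum>i\<le>degree p. \<Sum>j\<le>degree q.
      coeff p i * sobolev_term k (H k) i j * coeff q j)"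
    unfolding sobolev_inner_def by (intro sum.cong) auto
  also have "\<dots> = (\<Sum>i\<le>degree p. \<Sum>k\<le>d. \<Sum>j\<le>degree q.
      coeff p i * sobolev_term k (H k) i j * coeff q j)"
    by (rule sum.swap)
  also have "\<dots> = (\<Sum>i\<le>degree p. \<Sum>j\<le>degree q. \<Sum>k\<le>d.
      coeff p i * sobolev_term k (H k) i j * coeff q j)"
    by (intro sum.cong refl sum.swap)
  finally show ?thesis by (simp add: sum_distrib_left sum_distrib_right)
qed

lemma monom_bilinear_sum:
  fixes M :: imat
  shows "(\<Sum>i\<le>degree (monom (1::real) a). \<Sum>j\<le>degree (monom (1::real) b).
     coeff (monom 1 a) i * M i j * coeff (monom 1 b) j) = M a b"
proof -
  have "(\<Sum>i\<le>degree (monom (1::real) a). \<Sum>j\<le>degree (monom (1::real) b).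
      coeff (monom 1 a) i * M i j * coeff (monom 1 b) j)
      = (\<Sum>i\<le>a. \<Sum>j\<le>b. if j = b then if i = a then M i j else 0 else 0)"
    unfolding degree_monom_eq[OF one_neq_zero] by (intro sum.cong refl) simp
  also have "\<dots> = M a b" by simp
  finally show ?thesis .
qed

lemma pos_def_imat_moments_iff:
  assumes "\<And>i j. A i j = h (i + j)"
  shows "pos_def_imat A \<longleftrightarrow> (\<forall>p. p \<noteq> 0 \<longrightarrow> moment_functional h (p * p) > 0)"
  unfolding pos_def_imat_def det_hankel_mat_pos_iff[symmetric] assms ..

lemma sobolev_term_null: "sobolev_term k null_imat i j = 0"
  by (simp add: sobolev_term_nth null_imat_def)

text \<open>Null matrices beyond \<open>d\<close> turn the series into a finite sum, and limits are
  unique.\<close>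

lemma hankel_sobolev_decomp_finite_iff:
  assumes "\<And>k. hankel (H k)" "\<And>k. k > d \<Longrightarrow> H k = null_imat"
  shows "hankel_sobolev_decomp M H \<longleftrightarrow> M = (\<lambda>i j. \<Sum>k\<le>d. sobolev_term k (H k) i j)"
proof -
  have s: "(\<lambda>k. sobolev_term k (H k) i j) sums (\<Sum>k\<le>d. sobolev_term k (H k) i j)" for i j
    by (rule sums_finite) (auto simp: assms(2) sobolev_term_null)
  show ?thesis
    unfolding hankel_sobolev_decomp_def using assms(1) s sums_unique2[OF _ s] by (auto simp: fun_eq_iff)
qed

theorem theorem3:
  fixes G :: imat and t00 :: real
  assumes "nondegenerate_hessenberg G" and "t00 > 0"
  shows "(\<exists>d \<mu>. sobolev_measures d \<mu> \<and>
            (\<forall>k\<le>d. infinite (measure_support (\<mu> k))) \<and>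
            (\<forall>p q. sobolev_inner d \<mu> p q = formal_inner t00 G p q))
     \<longleftrightarrow>
         (\<exists>d. hessenberg_sobolev_of_index t00 d G \<and>
            (\<forall>k\<le>d. hankel (extracted (formal_moments t00 G) d k) \<and>
                   pos_def_imat (extracted (formal_moments t00 G) d k)))"
    (is "?L \<longleftrightarrow> ?R")
proof
  assume ?L
  then obtain d \<mu> where \<mu>: "sobolev_measures d \<mu>"
    and supp: "\<And>k. k \<le> d \<Longrightarrow> infinite (measure_support (\<mu> k))"
    and eq: "\<And>p q. sobolev_inner d \<mu> p q = formal_inner t00 G p q" by blast
  let ?M = "formal_moments t00 G"
  have sets: "sets (\<mu> k) = sets borel" and int: "integrable (\<mu> k) (poly p)" if "k \<le> d" for k p
    using \<mu> that by (auto simp: sobolev_measures_def)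
  have ints: "integrable (\<mu> k) (\<lambda>x. x ^ n)" if "k \<le> d" for k n
  proof -
    have "poly (monom 1 n) = (\<lambda>x :: real. x ^ n)" by (rule ext) (simp add: poly_monom)
    then show ?thesis using int[OF that, of "monom 1 n"] by simp
  qed
  define m where "m k n = (\<integral>x. x ^ n \<partial>\<mu> k)" for k n
  define H where "H k = (if k \<le> d then \<lambda>i j. m k (i + j) else null_imat)" for k
  have hankel: "hankel (H k)" for k by (simp add: H_def hankel_def null_imat_def)
  have null: "H k = null_imat" if "k > d" for k using that by (simp add: H_def)
  have M: "?M = (\<lambda>i j. \<Sum>k\<le>d. sobolev_term k (H k) i j)"
  proof (intro ext)
    fix i j
    have "?M i j = formal_inner t00 G (monom 1 i) (monom 1 j)"
      unfolding formal_inner_def by (rule monom_bilinear_sum[symmetric])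
    also have "\<dots> = sobolev_inner d \<mu> (monom 1 i) (monom 1 j)" by (rule eq[symmetric])
    also have "\<dots> = (\<Sum>k\<le>d. sobolev_term k (H k) i j)"
      by (subst sobolev_inner_eq_sum[where H = H])
        (simp_all add: ints H_def m_def monom_bilinear_sum del: coeff_monom)
    finally show "?M i j = (\<Sum>k\<le>d. sobolev_term k (H k) i j)" .
  qed
  have pos: "moment_functional (m k) (p * p) > 0" if "k \<le> d" "p \<noteq> 0" for k p
  proof -
    have m: "m k = (\<lambda>n. \<integral>x. x ^ n \<partial>\<mu> k)" by (rule ext) (simp add: m_def)
    have "poly (p * p) = (\<lambda>x. (poly p x)\<^sup>2)" by (auto simp: power2_eq_square)
    then have "moment_functional (m k) (p * p) = (\<integral>x. (poly p x)\<^sup>2 \<partial>\<mu> k)"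
      and "integrable (\<mu> k) (\<lambda>x. (poly p x)\<^sup>2)"
      using integral_poly_moments(2)[OF ints[OF that(1)], of "p * p"] int[OF that(1), of "p * p"]
      by (simp_all add: m)
    then show ?thesis
      using integral_square_pos_if_infinite_support[OF sets supp] that by simp
  qed
  have pd: "pos_def_imat (H k)" if "k \<le> d" for k
    using that pos by (subst pos_def_imat_moments_iff[of _ "m k"]) (simp_all add: H_def)
  \<comment> \<open>The total mass of \<open>\<mu> d\<close> is positive, so the top Hankel matrix
    is nonzero and the index is exactly \<open>d\<close>.\<close>
  have "H d 0 0 > 0"
    using pos[of d 1] by (simp add: H_def moment_functional_def)
  then have "H d \<noteq> null_imat" by (auto simp: null_imat_def)
  then have "hankel_sobolev_of_index d ?M"
    unfolding hankel_sobolev_of_index_def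
    using hankel_sobolev_decomp_finite_iff[of H d ?M] hankel null M by blast
  moreover have "extracted ?M d k = H (d - k)" if "k \<le> d" for k
    unfolding M by (rule extracted_sobolev_sum[OF hankel that])
  ultimately show ?R
    using assms(1) hankel pd by (intro exI[of _ d]) (simp add: hessenberg_sobolev_of_index_def)
next
  assume ?R
  let ?M = "formal_moments t00 G"
  obtain d where ind: "hankel_sobolev_of_index d ?M"
    and pd: "\<And>k. k \<le> d \<Longrightarrow> pos_def_imat (extracted ?M d k)"
    using \<open>?R\<close> by (auto simp: hessenberg_sobolev_of_index_def)
  obtain H where dec: "hankel_sobolev_decomp ?M H" and null: "\<And>k. k > d \<Longrightarrow> H k = null_imat"
    using ind by (auto simp: hankel_sobolev_of_index_def)
  have hankel: "hankel (H k)" for k using dec by (simp add: hankel_sobolev_decomp_def)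
  have M: "?M = (\<lambda>i j. \<Sum>k\<le>d. sobolev_term k (H k) i j)"
    using dec hankel_sobolev_decomp_finite_iff[of H d ?M] hankel null by blast
  \<comment> \<open>Step \<open>d - k\<close> of the extraction returns \<open>H k\<close>, so
    positivity of the extracted matrices carries over to this decomposition.\<close>
  have pdH: "pos_def_imat (H k)" if "k \<le> d" for k
    using pd[of "d - k"] extracted_sobolev_sum[of H "d - k" d] hankel that
    unfolding M by simp
  \<comment> \<open>A Hankel matrix is determined by its row 0, which serves as the moment sequence
    for \<open>\<mu> k\<close>.\<close>
  have pos: "moment_functional (H k 0) (p * p) > 0" if "k \<le> d" "p \<noteq> 0" for k p
    using pdH[OF that(1)] pos_def_imat_moments_iff[of "H k" "H k 0", OF hankel_nth[OF hankel]] that(2)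
    by blast
  have "\<exists>N. sets N = sets borel \<and> finite_measure N \<and> (\<forall>n. integrable N (\<lambda>x. x ^ n)) \<and>
      (\<forall>n. (\<integral>x. x ^ n \<partial>N) = H k 0 n)" if "k \<le> d" for k
    by (rule hamburger_moment_problem[of "H k 0"]) (use pos[OF that] in auto)
  then obtain \<mu> where \<mu>: "\<And>k. k \<le> d \<Longrightarrow> sets (\<mu> k) = sets borel"
      "\<And>k. k \<le> d \<Longrightarrow> finite_measure (\<mu> k)"
      "\<And>k n. k \<le> d \<Longrightarrow> integrable (\<mu> k) (\<lambda>x. x ^ n)"
      "\<And>k n. k \<le> d \<Longrightarrow> (\<integral>x. x ^ n \<partial>\<mu> k) = H k 0 n"
    by metis
  have supp: "infinite (measure_support (\<mu> k))" if "k \<le> d" for k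
  proof (rule infinite_support_if_square_pos[OF \<mu>(1)[OF that]])
    fix p :: "real poly" assume "p \<noteq> 0"
    have "(\<lambda>x. (poly p x)\<^sup>2) = poly (p * p)" by (auto simp: power2_eq_square)
    then have "(\<integral>x. (poly p x)\<^sup>2 \<partial>\<mu> k) = (\<integral>x. poly (p * p) x \<partial>\<mu> k)" by (simp only:)
    also have "\<dots> = moment_functional (H k 0) (p * p)"
      using integral_poly_moments(2)[OF \<mu>(3)[OF that], of "p * p"] \<mu>(4)[OF that] by simp
    finally show "(\<integral>x. (poly p x)\<^sup>2 \<partial>\<mu> k) > 0" using pos[OF that \<open>p \<noteq> 0\<close>] by simp
  qed
  have "emeasure (\<mu> 0) UNIV > 0"
  proof -
    have "measure_support (\<mu> 0) \<noteq> {}" using supp[of 0] by auto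
    then obtain x where "x \<in> measure_support (\<mu> 0)" by blast
    then show ?thesis unfolding measure_support_def using open_UNIV by blast
  qed
  then have "sobolev_measures d \<mu>"
    using \<mu> supp[of 0] integral_poly_moments(1)[OF \<mu>(3)] by (simp add: sobolev_measures_def)
  moreover have "sobolev_inner d \<mu> p q = formal_inner t00 G p q" for p q
    unfolding formal_inner_def M
    by (rule sobolev_inner_eq_sum) (use \<mu>(3,4) hankel_nth[OF hankel] in auto)
  ultimately show ?L using supp by blast
qed

end
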